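(* Let $\phi \in H^{\infty}(\mathbb{C}^+)$, with boundary function $t \mapsto \phi(it)$ on the imaginary axis. Then $$\limsup_{\theta \to \infty} \sup_{y \in \mathbb{R}} \frac{1}{2\theta} \int_{y-\theta}^{y+\theta} \mathrm{Re}(\phi(it))\,dt = \limsup_{x \to \infty} \sup_{y \in \mathbb{R}} \mathrm{Re}(\phi(x+iy))$$ and $$\liminf_{\theta \to \infty} \inf_{y \in \mathbb{R}} \frac{1}{2\theta} \int_{y-\theta}^{y+\theta} \mathrm{Re}(\phi(it))\,dt = \liminf_{x \to \infty} \inf_{y \in \mathbb{R}} \mathrm{Re}(\phi(x+iy)).$$ The same two equations hold with $\mathrm{Re}$ replaced by $\mathrm{Im}$ throughout.
   Context: $\mathbb{C}^+ = \{z \in \mathbb{C} : \mathrm{Re}(z) > 0\}$ is the right half plane and $H^{\infty}(\mathbb{C}^+)$ is the space of bounded analytic functions on $\mathbb{C}^+$. Each $\phi \in H^{\infty}(\mathbb{C}^+)$ has nontangential boundary limits $\phi(iy) = \lim_{x \to 0^+} \phi(x+iy)$ for almost every $y \in \mathbb{R}$; the function $y \mapsto \phi(iy)$ in $L^{\infty}(\mathbb{R})$ is the boundary function of $\phi$. *)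

theory Defs
  imports "HOL-Analysis.Analysis"
begin

definition right_half_plane :: "complex set" where
  "right_half_plane = {z. Re z > 0}"

text \<open>Elements are functions on the whole type \<^typ>\<open>complex\<close>; only their values on the open
  right half plane are constrained or used.\<close>

definition H_infinity :: "(complex \<Rightarrow> complex) set" where
  "H_infinity = {\<phi>. \<phi> analytic_on right_half_plane \<and> bounded (\<phi> ` right_half_plane)}"

text \<open>The boundary value at \<open>i y\<close> is the horizontal limit from inside the half plane, not the
  value of the HOL function at \<open>i y\<close>. By Fatou's theorem the limit exists for almost every \<open>y\<close>;
  on the exceptional null set \<^const>\<open>Lim\<close> returns an unspecified constant, which integrals do not
  see.\<close>

definition boundary_function :: "(complex \<Rightarrow> complex) \<Rightarrow> real \<Rightarrow> complex" where
  "boundary_function \<phi> y = Lim (at_right 0) (\<lambda>x. \<phi> (Complex x y))"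

end

theory Submission
  imports Defs "HOL-Complex_Analysis.Complex_Analysis" "HOL-Real_Asymp.Real_Asymp"
begin

text \<open>
  A primitive \<open>\<Phi>\<close> of a function \<open>\<phi>\<close> bounded by \<open>M\<close> is \<open>M\<close>-Lipschitz, hence extends to the closed half
  plane, and the averages of the boundary function of \<open>\<phi>\<close> are the symmetric difference quotients
  \<open>D y s = (\<Phi> (i(y + s)) - \<Phi> (i(y - s))) / (2 i s)\<close>. Integrating the Poisson formula by parts gives
  \<open>\<phi> (x + iy) = 4/\<pi> \<integral> q(s) D y (x s) ds\<close> over \<open>s > 0\<close>, with \<open>q(s) = s\<^sup>2 / (1 + s\<^sup>2)\<^sup>2\<close>; here it comes from
  Cauchy's theorem on half discs. As \<open>x \<rightarrow> 0\<close> the formula yields Fatou's theorem, because Lipschitz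
  functions are differentiable almost everywhere. As \<open>x \<rightarrow> \<infinity>\<close> it bounds \<open>Re \<phi> (x + iy)\<close> by the averages
  over long intervals. Conversely \<open>\<bar>\<Phi> (x + iy) - \<Phi> (iy)\<bar> \<le> M x\<close>, so an average of length \<open>2\<theta>\<close> on the
  imaginary axis differs from the one on the line \<open>Re z = x\<close> by at most \<open>M x / \<theta>\<close>.
\<close>

section \<open>Almost everywhere differentiability of Lipschitz functions\<close>

text \<open>Together with the interval measure of \<open>(x - u x) / 2\<close> this measure adds up to Lebesgue measure.\<close>

lemma absolutely_continuous_interval_measure:
  fixes u :: "real \<Rightarrow> real"
  assumes "\<And>x y. \<bar>u x - u y\<bar> \<le> \<bar>x - y\<bar>"
  shows "absolutely_continuous lborel (interval_measure (\<lambda>x. (x + u x) / 2))"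
proof -
  define F where "F = (\<lambda>x. (x + u x) / 2)"
  define G where "G = (\<lambda>x. (x - u x) / 2)"
  have "1-lipschitz_on UNIV u"
    using assms by (auto simp: lipschitz_on_def dist_real_def)
  then have "continuous_on UNIV u"
    by (rule lipschitz_on_continuous_on)
  then have cont: "continuous_on UNIV F" "continuous_on UNIV G"
    unfolding F_def G_def by (auto intro!: continuous_intros)
  have mono: "F x \<le> F y" "G x \<le> G y" if "x \<le> y" for x y
    using assms[of x y] that by (auto simp: F_def G_def)
  \<comment> \<open>The sum of the interval measures of \<open>F\<close> and \<open>G\<close>. Both
    functions are nondecreasing because \<open>u\<close> is nonexpansive.\<close>
  define M where "M = measure_of UNIV (sets borel)
    (\<lambda>A. emeasure (interval_measure F) A + emeasure (interval_measure G) A)"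
  have sets_M: "sets M = sets borel"
    unfolding M_def by (simp add: sets.sigma_sets_eq[of borel, simplified])
  have emeasure_M: "emeasure M A = emeasure (interval_measure F) A + emeasure (interval_measure G) A"
    if "A \<in> sets borel" for A
    unfolding M_def
  proof (rule emeasure_measure_of_sigma)
    show "sigma_algebra UNIV (sets (borel :: real measure))"
      using sets.sigma_algebra_axioms[of borel] by simp
    show "countably_additive (sets borel)
      (\<lambda>A. emeasure (interval_measure F) A + emeasure (interval_measure G) A)"
      by (auto simp: countably_additive_def suminf_add[symmetric] suminf_emeasure)
  qed (use that in \<open>auto simp: positive_def\<close>)
  have sing: "emeasure (interval_measure H) {b} = 0"
    if "\<And>x y. x \<le> y \<Longrightarrow> H x \<le> H y" "continuous_on UNIV H" for H and b :: real
    using emeasure_interval_measure_Icc[of b b H] that by simp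
  have Ioo: "emeasure (interval_measure H) {a<..<b} = ennreal (H b - H a)"
    if "\<And>x y. x \<le> y \<Longrightarrow> H x \<le> H y" "continuous_on UNIV H" "a \<le> b" for H and a b :: real
  proof (cases "a = b")
    case False
    have "emeasure (interval_measure H) {a<..b} =
      emeasure (interval_measure H) {a<..<b} + emeasure (interval_measure H) {b}"
      using that False by (subst plus_emeasure) (auto intro: arg_cong2[where f = emeasure])
    moreover have "continuous (at_right c) H" for c
      using that(2) by (meson UNIV_I continuous_at_imp_continuous_within continuous_on_eq_continuous_at open_UNIV)
    ultimately show ?thesis
      using that by (simp add: sing emeasure_interval_measure_Ioc)
  qed simp
  \<comment> \<open>\<open>F + G\<close> is the identity, so the two measures of a box add up to its
    length. As neither summand is negative, a Lebesgue null set is then null for the measure of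
    \<open>F\<close>.\<close>
  have lborel_eq: "lborel = M"
  proof (rule lborel_eqI)
    fix l r :: real assume "\<And>b. b \<in> Basis \<Longrightarrow> l \<bullet> b \<le> r \<bullet> b"
    then have "l \<le> r" by simp
    then have "emeasure M (box l r) = ennreal (F r - F l) + ennreal (G r - G l)"
      by (simp add: emeasure_M Ioo mono cont)
    also have "\<dots> = ennreal (r - l)"
      using \<open>l \<le> r\<close> mono by (subst ennreal_plus[symmetric]) (auto simp: F_def G_def field_simps)
    finally show "emeasure M (box l r) = (\<Prod>b\<in>Basis. (r - l) \<bullet> b)" by simp
  qed (simp add: sets_M)
  have "emeasure (interval_measure F) A = 0" if "A \<in> null_sets lborel" for A
  proof -
    have "emeasure M A = 0" "A \<in> sets borel"
      using that by (auto simp: null_sets_def simp flip: lborel_eq)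
    then show ?thesis
      using emeasure_M by auto
  qed
  then show ?thesis
    unfolding F_def[symmetric] absolutely_continuous_def
    by (auto simp: null_sets_def)
qed

text \<open>Absolute continuity gives the interval measure of \<open>(x + u x) / 2\<close> a
  Radon-Nikodym density, and a linear change of that density integrates back to \<open>u\<close>.
  Writing \<open>u\<close> as an indefinite integral makes Lebesgue's differentiation theorem
  available.\<close>

lemma nonexpansive_primitive:
  fixes u :: "real \<Rightarrow> real"
  assumes "\<And>x y. \<bar>u x - u y\<bar> \<le> \<bar>x - y\<bar>"
  obtains f where "\<And>a b. a \<le> b \<Longrightarrow> (f has_integral (u b - u a)) {a..b}"
proof -
  define F where "F = (\<lambda>x. (x + u x) / 2)"
  define N where "N = interval_measure F"
  have "1-lipschitz_on UNIV u"
    using assms by (auto simp: lipschitz_on_def dist_real_def)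
  then have "continuous_on UNIV u"
    by (rule lipschitz_on_continuous_on)
  then have cont: "continuous_on UNIV F"
    unfolding F_def by (auto intro!: continuous_intros)
  have mono: "F x \<le> F y" if "x \<le> y" for x y
    using assms[of x y] that by (auto simp: F_def)
  have ac: "absolutely_continuous lborel N"
    unfolding N_def F_def by (rule absolutely_continuous_interval_measure[OF assms])
  have sets_N: "sets N = sets lborel"
    by (simp add: N_def)
  have "continuous (at_right c) F" for c
    using cont by (meson UNIV_I continuous_at_imp_continuous_within continuous_on_eq_continuous_at open_UNIV)
  then have sf: "sigma_finite_measure N"
    unfolding N_def by (intro sigma_finite_interval_measure mono)
  define f where "f = RN_deriv lborel N"
  have [measurable]: "f \<in> borel_measurable borel"
    unfolding f_def using borel_measurable_RN_deriv[of lborel N] by simp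
  \<comment> \<open>The density has extended values. Finiteness almost everywhere is what lets
    \<open>enn2real\<close> replace it without changing integrals.\<close>
  have fin: "AE x in lborel. f x \<noteq> \<infinity>"
    unfolding f_def by (rule sigma_finite_measure.RN_deriv_finite[OF sigma_finite_lborel sf ac sets_N])
  have dens: "density lborel f = N"
    unfolding f_def by (rule sigma_finite_measure.density_RN_deriv[OF sigma_finite_lborel ac sets_N])
  have "((\<lambda>x. enn2real (f x)) has_integral (F b - F a)) {a..b}" if "a \<le> b" for a b
  proof -
    have "ennreal (F b - F a) = emeasure N {a..b}"
      using that mono cont by (simp add: N_def emeasure_interval_measure_Icc)
    also have "\<dots> = (\<integral>\<^sup>+x. f x * indicator {a..b} x \<partial>lborel)"
      by (simp add: dens[symmetric] emeasure_density)
    also have "\<dots> = (\<integral>\<^sup>+x. ennreal (indicator {a..b} x * enn2real (f x)) \<partial>lborel)"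
      using fin by (intro nn_integral_cong_AE) (auto simp: indicator_def less_top)
    finally have "((\<lambda>x. indicator {a..b} x * enn2real (f x)) has_integral (F b - F a)) UNIV"
      using mono[OF that] by (intro nn_integral_has_integral) auto
    then have "((\<lambda>x. if x \<in> {a..b} then enn2real (f x) else 0) has_integral (F b - F a)) UNIV"
      by (rule has_integral_eq_rhs[OF has_integral_eq, rotated 1]) (auto simp: indicator_def)
    then show ?thesis
      by (simp only: has_integral_restrict_UNIV)
  qed
  \<comment> \<open>From \<open>F x = (x + u x) / 2\<close> one has
    \<open>u x = 2 * F x - x\<close>, so the density of \<open>u\<close> is twice that of
    \<open>F\<close> minus 1.\<close>
  then have "((\<lambda>x. 2 * enn2real (f x) - 1) has_integral (2 * (F b - F a) - (b - a))) {a..b}" if "a \<le> b" for a b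
    using that has_integral_const_real[of "1::real" a b]
    by (intro has_integral_diff has_integral_mult_right) auto
  then show ?thesis
    by (intro that[of "\<lambda>x. 2 * enn2real (f x) - 1"]) (auto simp: F_def diff_divide_distrib add_divide_distrib algebra_simps)
qed

text \<open>Lebesgue's differentiation theorem for the density of \<open>u\<close> gives right and
  left derivatives almost everywhere, with the same value. The symmetric quotient is the mean of the
  two one-sided quotients.\<close>

lemma lipschitz_AE_symmetric_derivative:
  fixes u :: "real \<Rightarrow> real"
  assumes "L-lipschitz_on UNIV u"
  shows "AE y in lborel. \<exists>l. ((\<lambda>s. (u (y + s) - u (y - s)) / (2 * s)) \<longlongrightarrow> l) (at_right 0)"
proof -
  have "L \<ge> 0" using assms lipschitz_on_nonneg by blast
  \<comment> \<open>Dividing by \<open>L + 1\<close> instead of \<open>L\<close> makes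
    \<open>u\<close> nonexpansive and stays meaningful for \<open>L = 0\<close>.\<close>
  define v where "v = (\<lambda>x. u x / (L + 1))"
  have "\<bar>v x - v y\<bar> \<le> \<bar>x - y\<bar>" for x y
  proof -
    have "\<bar>u x - u y\<bar> \<le> L * \<bar>x - y\<bar>"
      using lipschitz_onD[OF assms, of x y] by (simp add: dist_real_def)
    also have "\<dots> \<le> (L + 1) * \<bar>x - y\<bar>"
      by (simp add: mult_right_mono)
    finally show ?thesis
      using \<open>L \<ge> 0\<close> by (simp add: v_def flip: diff_divide_distrib) (simp add: field_simps)
  qed
  then obtain f where f: "\<And>a b. a \<le> b \<Longrightarrow> (f has_integral (v b - v a)) {a..b}"
    using nonexpansive_primitive by blast
  then have "f integrable_on cbox a b" for a b
    by (cases "a \<le> b") (auto simp: integrable_on_def)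
  then obtain N1 where N1: "negligible N1" and
    "\<And>x e. \<lbrakk>x \<notin> N1; 0 < e\<rbrakk> \<Longrightarrow> \<exists>d>0. \<forall>h. 0 < h \<and> h < d \<longrightarrow>
      norm (integral (cbox x (x + h *\<^sub>R One)) f /\<^sub>R h ^ DIM(real) - f x) < e"
    using integrable_ccontinuous_explicit[of f] by blast
  then have R: "\<exists>d>0. \<forall>h. 0 < h \<and> h < d \<longrightarrow> \<bar>(v (x + h) - v x) / h - f x\<bar> < e"
    if "x \<notin> N1" "0 < e" for x e
    using that integral_unique[OF f] by (fastforce simp: divide_inverse mult.commute)
  \<comment> \<open>The differentiation theorem is used for intervals that start at the point, which
    yields right derivatives. Reflection turns left derivatives into right ones; the exceptional set
    \<open>N2\<close> lives in the reflected variable.\<close>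
  define g where "g = (\<lambda>x. f (- x))"
  have g: "(g has_integral (v (- a) - v (- b))) {a..b}" if "a \<le> b" for a b
    using f[of "- b" "- a"] that unfolding g_def
    by (subst has_integral_reflect_real[symmetric]) auto
  then have "g integrable_on cbox a b" for a b
    by (cases "a \<le> b") (auto simp: integrable_on_def)
  then obtain N2 where N2: "negligible N2" and
    "\<And>x e. \<lbrakk>x \<notin> N2; 0 < e\<rbrakk> \<Longrightarrow> \<exists>d>0. \<forall>h. 0 < h \<and> h < d \<longrightarrow>
      norm (integral (cbox x (x + h *\<^sub>R One)) g /\<^sub>R h ^ DIM(real) - g x) < e"
    using integrable_ccontinuous_explicit[of g] by blast
  then have L: "\<exists>d>0. \<forall>h. 0 < h \<and> h < d \<longrightarrow> \<bar>(v (- x) - v (- x - h)) / h - g x\<bar> < e"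
    if "x \<notin> N2" "0 < e" for x e
    using that integral_unique[OF g] by (fastforce simp: divide_inverse mult.commute)
  have lim: "((\<lambda>s. (u (y + s) - u (y - s)) / (2 * s)) \<longlongrightarrow> (L + 1) * f y) (at_right 0)"
    if y: "y \<notin> N1" "- y \<notin> N2" for y
  proof -
    have "((\<lambda>s. (v (y + s) - v y) / s) \<longlongrightarrow> f y) (at_right 0)"
      unfolding tendsto_iff eventually_at_right_field dist_real_def using R[OF y(1)] by meson
    moreover have "((\<lambda>s. (v y - v (y - s)) / s) \<longlongrightarrow> f y) (at_right 0)"
      using L[OF y(2)] unfolding tendsto_iff eventually_at_right_field dist_real_def g_def minus_minus by meson
    ultimately have "((\<lambda>s. (L + 1) / 2 * ((v (y + s) - v y) / s + (v y - v (y - s)) / s)) \<longlongrightarrow>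
        (L + 1) / 2 * (f y + f y)) (at_right 0)"
      by (intro tendsto_intros)
    moreover have "(L + 1) / 2 * ((v (y + s) - v y) / s + (v y - v (y - s)) / s) =
        (u (y + s) - u (y - s)) / (2 * s)" for s
    proof -
      have "(L + 1) * v x = u x" for x
        using \<open>L \<ge> 0\<close> by (simp add: v_def)
      moreover have "(L + 1) / 2 * ((v (y + s) - v y) / s + (v y - v (y - s)) / s) =
          ((L + 1) * v (y + s) - (L + 1) * v (y - s)) / (2 * s)"
        by (simp add: divide_simps) (simp add: algebra_simps)
      ultimately show ?thesis by (simp only:)
    qed
    ultimately show ?thesis by (simp only: mult_2[symmetric] times_divide_eq_left) simp
  qed
  have "negligible (N1 \<union> uminus ` N2)"
    using N1 N2
    by (intro negligible_Un negligible_differentiable_image_negligible)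
       (auto intro!: derivative_intros)
  then have "AE y in lebesgue. \<exists>l. ((\<lambda>s. (u (y + s) - u (y - s)) / (2 * s)) \<longlongrightarrow> l) (at_right 0)"
  proof (intro AE_I')
    show "{y \<in> space lebesgue. \<not> (\<exists>l. ((\<lambda>s. (u (y + s) - u (y - s)) / (2 * s)) \<longlongrightarrow> l) (at_right 0))}
      \<subseteq> N1 \<union> uminus ` N2"
      using lim by (auto simp: image_iff) (metis minus_minus)
  qed (simp add: negligible_iff_null_sets)
  then show ?thesis
    by (simp only: AE_completion_iff)
qed

section \<open>Reproducing a function from its boundary difference quotients\<close>

text \<open>This is \<open>- s / 2\<close> times the derivative of
  \<open>1 / (1 + s\<^sup>2)\<close>, which is the Poisson kernel at distance 1 up to a factor
  \<pi>. It is what integration by parts leaves when boundary values are replaced by their symmetric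
  averages.\<close>

definition half_plane_kernel :: "real \<Rightarrow> real" where
  "half_plane_kernel s = s\<^sup>2 / (1 + s\<^sup>2)\<^sup>2"

lemma half_plane_kernel_nonneg: "half_plane_kernel s \<ge> 0"
  by (simp add: half_plane_kernel_def)

lemma borel_measurable_half_plane_kernel [measurable]: "half_plane_kernel \<in> borel_measurable borel"
  unfolding half_plane_kernel_def by measurable

text \<open>An explicit antiderivative is \<open>(arctan s - s / (1 + s\<^sup>2)) / 2\<close>. Hence
  \<open>4 / pi\<close> times the kernel is a probability density on the half line, and the
  reproducing formula is a weighted mean of averages.\<close>

lemma has_bochner_integral_half_plane_kernel:
  "has_bochner_integral lborel (\<lambda>s. indicator {0..} s *\<^sub>R half_plane_kernel s) (pi / 4)"
proof (rule has_bochner_integral_nn_integral)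
  define F where "F = (\<lambda>s. (arctan s - s / (1 + s\<^sup>2)) / 2)"
  have nz: "1 + s\<^sup>2 \<noteq> 0" for s :: real
    by (smt (verit) zero_le_power2)
  have "(\<integral>\<^sup>+s. ennreal (half_plane_kernel s) * indicator {0..} s \<partial>lborel) = ennreal (pi / 4 - F 0)"
  proof (rule nn_integral_FTC_atLeast)
    have "(F has_field_derivative
        (inverse (1 + x\<^sup>2) - (1 * (1 + x\<^sup>2) - x * (2 * x)) / ((1 + x\<^sup>2) * (1 + x\<^sup>2))) / 2) (at x)" for x
      unfolding F_def using nz[of x]
      by (auto intro!: derivative_eq_intros)
    moreover have "(inverse (1 + x\<^sup>2) - (1 * (1 + x\<^sup>2) - x * (2 * x)) / ((1 + x\<^sup>2) * (1 + x\<^sup>2))) / 2 =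
        half_plane_kernel x" for x
    proof -
      have "(inverse t - (1 * t - x * (2 * x)) / (t * t)) / 2 = x\<^sup>2 / t\<^sup>2" if "t \<noteq> 0" for t
        using that by (simp add: field_simps power2_eq_square)
      then show ?thesis
        using nz[of x] by (simp add: half_plane_kernel_def)
    qed
    ultimately show "(F has_field_derivative half_plane_kernel x) (at x)" for x
      by simp
    have "((\<lambda>s. (arctan s - s / (1 + s\<^sup>2)) / 2) \<longlongrightarrow> (pi / 2 - 0) / 2) at_top"
    proof (intro tendsto_intros tendsto_arctan_at_top)
      show "((\<lambda>s::real. s / (1 + s\<^sup>2)) \<longlongrightarrow> 0) at_top"
        by real_asymp
    qed auto
    then show "(F \<longlongrightarrow> pi / 4) at_top"
      by (simp add: F_def)
  qed (simp_all add: half_plane_kernel_nonneg)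
  then show "(\<integral>\<^sup>+s. ennreal (indicator {0..} s *\<^sub>R half_plane_kernel s) \<partial>lborel) = ennreal (pi / 4)"
    by (simp add: F_def ennreal_mult' mult.commute half_plane_kernel_nonneg flip: ennreal_indicator)
qed (auto simp: half_plane_kernel_nonneg)

section \<open>Cauchy's theorem on half discs\<close>

text \<open>Taking the divided difference at 1 twice removes the double zero of the Taylor
  remainder; both singularities are removable. The quotient remains continuous up to the imaginary
  axis, as Cauchy's theorem on half discs requires.\<close>

lemma half_plane_quotient:
  fixes \<Phi> :: "complex \<Rightarrow> complex"
  assumes holo: "\<Phi> holomorphic_on {z. Re z > 0}" and cont: "continuous_on {z. Re z \<ge> 0} \<Phi>"
  obtains p where "continuous_on {z. Re z \<ge> 0} p" "p holomorphic_on {z. Re z > 0}"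
    "\<And>z. z \<noteq> 1 \<Longrightarrow> p z = (\<Phi> z - \<Phi> 1 - deriv \<Phi> 1 * (z - 1)) / (z - 1)\<^sup>2"
proof -
  define p1 where "p1 z = (if z = 1 then deriv \<Phi> 1 else (\<Phi> z - \<Phi> 1) / (z - 1))" for z
  define p where "p z = (if z = 1 then deriv p1 1 else (p1 z - p1 1) / (z - 1))" for z
  have "open {z. Re z > 0}"
    by (rule open_halfspace_Re_gt)
  then have "p1 holomorphic_on {z. Re z > 0}"
    unfolding p1_def using holo by (intro pole_lemma_open)
  then have holp: "p holomorphic_on {z. Re z > 0}"
    unfolding p_def using \<open>open _\<close> by (intro pole_lemma_open)
  have p: "p z = (\<Phi> z - \<Phi> 1 - deriv \<Phi> 1 * (z - 1)) / (z - 1)\<^sup>2" if "z \<noteq> 1" for z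
    using that by (simp add: p_def p1_def divide_simps power2_eq_square)
  \<comment> \<open>Two relatively open pieces cover the closed half plane: holomorphy gives
    continuity around 1, and the explicit formula gives it away from 1, including on the imaginary
    axis.\<close>
  have "continuous_on ({z. Re z > 0} \<union> ({z. Re z \<ge> 0} - {1})) p"
  proof (rule continuous_on_Un_local_open)
    show "openin (top_of_set ({z. Re z > 0} \<union> ({z. Re z \<ge> 0} - {1}))) {z. Re z > 0}"
      using \<open>open _\<close> by (auto simp: openin_open)
    show "openin (top_of_set ({z. Re z > 0} \<union> ({z. Re z \<ge> 0} - {1}))) ({z. Re z \<ge> 0} - {1})"
      unfolding openin_open by (rule exI[of _ "- {1}"]) auto
    show "continuous_on {z. Re z > 0} p"
      using holp by (rule holomorphic_on_imp_continuous_on)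
    have "continuous_on ({z. Re z \<ge> 0} - {1}) (\<lambda>z. (\<Phi> z - \<Phi> 1 - deriv \<Phi> 1 * (z - 1)) / (z - 1)\<^sup>2)"
      by (intro continuous_intros continuous_on_subset[OF cont]) auto
    then show "continuous_on ({z. Re z \<ge> 0} - {1}) p"
      by (rule continuous_on_eq) (auto simp: p)
  qed
  moreover have "{z. Re z > 0} \<union> ({z. Re z \<ge> 0} - {1}) = {z. Re z \<ge> 0}"
    by auto
  ultimately show ?thesis
    using that holp p by metis
qed

text \<open>The integral around the half disc vanishes, so the integral along the diameter has the
  same norm as the one along the arc, which is at most \<open>B\<close> times the arc length
  \<open>R * pi\<close>.\<close>

lemma Cauchy_half_disc:
  assumes cont: "continuous_on {z. Re z \<ge> 0} F" and holo: "F holomorphic_on {z. Re z > 0}"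
    and "R > 0" and bound: "\<And>z. Re z \<ge> 0 \<Longrightarrow> norm z = R \<Longrightarrow> norm (F z) \<le> B"
  obtains I where "((\<lambda>s. F (Complex 0 s)) has_integral I) {-R..R}" "norm I \<le> B * R * pi"
proof -
  define c where "c = part_circlepath 0 R (- (pi / 2)) (pi / 2)"
  define l where "l = linepath (Complex 0 R) (Complex 0 (- R))"
  have ends: "pathstart c = Complex 0 (- R)" "pathfinish c = Complex 0 R"
    by (auto simp: c_def exp_eq_polar complex_eq_iff)
  have imc: "norm z = R" "Re z \<ge> 0" if "z \<in> path_image c" for z
  proof -
    from that obtain x where x: "x \<in> {- (pi / 2)..pi / 2}" and z: "z = of_real R * cis x"
      unfolding c_def by (auto simp: path_image_part_circlepath' linepath_def closed_segment_eq_real_ivl)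
    show "norm z = R" "Re z \<ge> 0"
      using \<open>R > 0\<close> x by (auto simp: z norm_mult intro!: mult_nonneg_nonneg cos_ge_zero)
  qed
  have iml: "Re z \<ge> 0" if "z \<in> path_image l" for z
    using that by (auto simp: l_def closed_segment_def)
  have "(F has_contour_integral 0) (c +++ l)"
  proof (rule Cauchy_theorem_convex[where K = "{}"])
    show "convex {z. Re z \<ge> 0}" by (rule convex_halfspace_Re_ge)
    show "F field_differentiable at x" if "x \<in> interior {z. Re z \<ge> 0} - {}" for x
      using that holo interior_halfspace_ge[of "1::complex" 0]
      by (auto simp: inner_complex_def holomorphic_on_open[OF open_halfspace_Re_gt] field_differentiable_def)
    show "valid_path (c +++ l)"
      using ends by (intro valid_path_join) (auto simp: c_def l_def)
    show "path_image (c +++ l) \<subseteq> {z. Re z \<ge> 0}"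
      using imc iml path_image_join_subset[of c l] by blast
  qed (use cont ends in \<open>auto simp: l_def\<close>)
  then have int: "F contour_integrable_on (c +++ l)" and "contour_integral (c +++ l) F = 0"
    by (auto simp: contour_integrable_on_def contour_integral_unique)
  then have ints: "F contour_integrable_on c" "F contour_integrable_on l"
    by (auto simp: c_def l_def)
  with \<open>contour_integral (c +++ l) F = 0\<close> have sum: "contour_integral c F + contour_integral l F = 0"
    by (simp add: c_def l_def)
  have "(F has_contour_integral (contour_integral c F)) c"
    using ints(1) by (rule has_contour_integral_integral)
  then have "norm (contour_integral c F) \<le> B * R * (pi / 2 - - (pi / 2))"
    unfolding c_def
  proof (rule has_contour_integral_bound_part_circlepath)
    have "norm (F (Complex R 0)) \<le> B" using bound[of "Complex R 0"] \<open>R > 0\<close> by (simp add: complex_norm)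
    then show "B \<ge> 0" by (smt (verit) norm_ge_zero)
  qed (use \<open>R > 0\<close> imc bound in \<open>auto simp: c_def\<close>)
  then have bd: "norm (contour_integral c F) \<le> B * R * pi" by simp
  have "(F has_contour_integral (contour_integral l F)) l"
    using ints(2) by (rule has_contour_integral_integral)
  then have "(F has_contour_integral (- contour_integral l F)) (linepath (Complex 0 (- R)) (Complex 0 R))"
    unfolding l_def by (rule has_contour_integral_reverse_linepath)
  \<comment> \<open>The segment is parametrized by \<open>\<i> * s\<close>, so passing from the
    contour integral to the integral over \<open>s\<close> divides by \<open>\<i>\<close>.\<close>
  then have "((\<lambda>s. F (Complex 0 s)) has_integral (- \<i> * (- contour_integral l F))) {-R..R}"
    using \<open>R > 0\<close> by (subst (asm) has_contour_integral_linepath_same_Re_iff) auto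
  moreover have "contour_integral l F = - contour_integral c F"
    using sum by (simp add: add_eq_0_iff)
  ultimately show ?thesis
    using bd that[of "- \<i> * (- contour_integral l F)"] by (simp add: norm_mult)
qed

lemma has_integral_symmetrize:
  fixes f :: "real \<Rightarrow> 'a::banach"
  assumes "(f has_integral I) {-R..R}" "R \<ge> 0"
  shows "((\<lambda>s. f s + f (- s)) has_integral I) {0..R}"
proof -
  have int: "f integrable_on {-R..R}" using assms by auto
  then have "f integrable_on {0..R}" "f integrable_on {-R..0}"
    using assms by (auto intro: integrable_subinterval_real)
  then have 1: "(f has_integral integral {0..R} f) {0..R}" and
    2: "(f has_integral integral {-R..0} f) {-R..0}"
    by auto
  have "((\<lambda>s. f (- s)) has_integral integral {-R..0} f) {0..R}"
    using 2 by (subst has_integral_reflect_real[symmetric]) simp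
  from has_integral_add[OF 1 this] have
    "((\<lambda>s. f s + f (- s)) has_integral (integral {0..R} f + integral {-R..0} f)) {0..R}" .
  moreover have "integral {-R..0} f + integral {0..R} f = integral {-R..R} f"
    using assms int by (intro Henstock_Kurzweil_Integration.integral_combine) auto
  ultimately show ?thesis
    using assms by (simp add: add.commute integral_unique)
qed

text \<open>
  Subtracting from \<open>\<Phi>\<close> its first order Taylor polynomial at \<open>1\<close> cancels the double pole of
  \<open>z / (z\<^sup>2 - 1)\<^sup>2\<close>, so that Cauchy's theorem suffices and no residue is needed.
\<close>

lemma half_plane_kernel_truncated:
  fixes \<Phi> :: "complex \<Rightarrow> complex"
  assumes holo: "\<Phi> holomorphic_on {z. Re z > 0}" and lip: "L-lipschitz_on {z. Re z \<ge> 0} \<Phi>"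
    and "R \<ge> 2"
  obtains I where "((\<lambda>s. of_real (half_plane_kernel s) *
      ((\<Phi> (Complex 0 s) - \<Phi> (Complex 0 (- s))) / (2 * \<i> * of_real s) - deriv \<Phi> 1)) has_integral I) {0..R}"
    "norm I \<le> 4 * pi * (L + norm (deriv \<Phi> 1)) / R"
proof -
  define d where "d = deriv \<Phi> 1"
  define C where "C = L + norm d"
  have "C \<ge> 0" using lipschitz_on_nonneg[OF lip] by (simp add: C_def)
  obtain p where contp: "continuous_on {z. Re z \<ge> 0} p" and holp: "p holomorphic_on {z. Re z > 0}"
    and p: "\<And>z. z \<noteq> 1 \<Longrightarrow> p z = (\<Phi> z - \<Phi> 1 - d * (z - 1)) / (z - 1)\<^sup>2"
    using half_plane_quotient[OF holo lipschitz_on_continuous_on[OF lip]] unfolding d_def by metis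
  have nz: "z + 1 \<noteq> 0" if "Re z \<ge> 0" for z
    using that by (auto simp: complex_eq_iff)
  \<comment> \<open>Away from 1 this is the Taylor remainder times
    \<open>z / (z\<^sup>2 - 1)\<^sup>2\<close>. The zero of \<open>z - 1\<close> is absorbed in
    \<open>p\<close>, and that of \<open>z + 1\<close> lies outside the closed half plane.\<close>
  define F where "F = (\<lambda>z. p z * (z / (z + 1)\<^sup>2))"
  have bound: "norm (F z) \<le> 8 * C / R\<^sup>2" if z: "Re z \<ge> 0" "norm z = R" for z
  proof -
    have "z \<noteq> 1" using z \<open>R \<ge> 2\<close> by auto
    \<comment> \<open>For \<open>R \<ge> 2\<close> one has \<open>R - 1 \<ge> R / 2\<close>. Each
      factor of \<open>F\<close> is then of order \<open>1 / R\<close>, so over an arc of length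
      \<open>R * pi\<close> the integral is of order \<open>1 / R\<close>.\<close>
    have lo: "norm (z - 1) \<ge> R / 2" "norm (z + 1) \<ge> R / 2"
      using norm_triangle_ineq2[of z 1] norm_diff_ineq[of z 1] z \<open>R \<ge> 2\<close> by auto
    have "norm (\<Phi> z - \<Phi> 1) \<le> L * norm (z - 1)"
      using lipschitz_onD[OF lip, of z 1] z by (simp add: dist_norm)
    then have "norm (\<Phi> z - \<Phi> 1 - d * (z - 1)) \<le> C * norm (z - 1)"
      using norm_triangle_ineq4[of "\<Phi> z - \<Phi> 1" "d * (z - 1)"]
      unfolding C_def distrib_right norm_mult by linarith
    then have "norm (p z) \<le> C * norm (z - 1) / (norm (z - 1))\<^sup>2"
      using \<open>z \<noteq> 1\<close> by (simp add: p norm_divide norm_power divide_right_mono)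
    also have "\<dots> = C / norm (z - 1)"
      using \<open>z \<noteq> 1\<close> by (simp add: power2_eq_square)
    also have "\<dots> \<le> C / (R / 2)"
      using lo \<open>C \<ge> 0\<close> \<open>R \<ge> 2\<close> \<open>z \<noteq> 1\<close> by (intro divide_left_mono mult_pos_pos) auto
    finally have 1: "norm (p z) \<le> C / (R / 2)" .
    have "norm (z / (z + 1)\<^sup>2) \<le> R / (R / 2)\<^sup>2"
      unfolding norm_divide norm_power z(2)
      using lo \<open>R \<ge> 2\<close> by (intro divide_left_mono power_mono mult_pos_pos) auto
    with 1 have "norm (F z) \<le> C / (R / 2) * (R / (R / 2)\<^sup>2)"
      unfolding F_def norm_mult using \<open>C \<ge> 0\<close> \<open>R \<ge> 2\<close> by (intro mult_mono) auto
    also have "\<dots> = 8 * C / R\<^sup>2"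
      using \<open>R \<ge> 2\<close> by (simp add: field_simps power2_eq_square)
    finally show ?thesis .
  qed
  have "continuous_on {z. Re z \<ge> 0} F" "F holomorphic_on {z. Re z > 0}"
    unfolding F_def using nz by (auto intro!: continuous_intros contp holomorphic_intros holp)
  then obtain I where I: "((\<lambda>s. F (Complex 0 s)) has_integral I) {-R..R}" and
    nI: "norm I \<le> 8 * C / R\<^sup>2 * R * pi"
    using Cauchy_half_disc[of F R "8 * C / R\<^sup>2"] bound \<open>R \<ge> 2\<close> by auto
  \<comment> \<open>The weight \<open>z / (1 - z\<^sup>2)\<^sup>2\<close> is odd, so pairing
    \<open>s\<close> with \<open>- s\<close> cancels the constant part of the Taylor polynomial and
    leaves the symmetric difference of \<Phi>. The sign comes from
    \<open>w\<^sup>2 = - s\<^sup>2\<close>. At \<open>s = 0\<close> both sides vanish.\<close>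
  have sym: "F (Complex 0 s) + F (Complex 0 (- s)) = - 2 * (of_real (half_plane_kernel s) *
      ((\<Phi> (Complex 0 s) - \<Phi> (Complex 0 (- s))) / (2 * \<i> * of_real s) - d))" for s
  proof (cases "s = 0")
    case False
    define w where "w = Complex 0 s"
    have w: "w = \<i> * of_real s" "Complex 0 (- s) = - w"
      by (auto simp: w_def complex_eq_iff)
    have ne: "w \<noteq> 1" "- w \<noteq> 1" "w \<noteq> 0"
      using False by (auto simp: w_def complex_eq_iff)
    have w2: "w\<^sup>2 = - of_real (s\<^sup>2)"
      by (simp add: w power_mult_distrib)
    have "F w = (\<Phi> w - \<Phi> 1 - d * (w - 1)) * w / (1 - w\<^sup>2)\<^sup>2"
    proof -
      have "(1 - w\<^sup>2)\<^sup>2 = (w - 1)\<^sup>2 * (w + 1)\<^sup>2"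
        by (simp add: power2_eq_square algebra_simps)
      then show ?thesis using ne by (simp add: F_def p)
    qed
    moreover have "F (- w) = (\<Phi> (- w) - \<Phi> 1 - d * (- w - 1)) * (- w) / (1 - w\<^sup>2)\<^sup>2"
    proof -
      have "(1 - w\<^sup>2)\<^sup>2 = (- w - 1)\<^sup>2 * (- w + 1)\<^sup>2"
        by (simp add: power2_eq_square algebra_simps)
      then show ?thesis using ne by (simp add: F_def p)
    qed
    ultimately have "F w + F (- w) = (\<Phi> w - \<Phi> (- w) - 2 * d * w) * w / (1 - w\<^sup>2)\<^sup>2"
      by (simp add: algebra_simps flip: add_divide_distrib diff_divide_distrib)
    also have "\<dots> = 2 * (w\<^sup>2 / (1 - w\<^sup>2)\<^sup>2 * ((\<Phi> w - \<Phi> (- w)) / (2 * w) - d))"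
    proof -
      have "(\<Phi> w - \<Phi> (- w) - 2 * d * w) * w = 2 * (w\<^sup>2 * ((\<Phi> w - \<Phi> (- w)) / (2 * w) - d))"
        using ne by (simp add: field_simps power2_eq_square)
      then show ?thesis by simp
    qed
    also have "w\<^sup>2 / (1 - w\<^sup>2)\<^sup>2 = - of_real (half_plane_kernel s)"
      by (simp add: w2 half_plane_kernel_def)
    finally show ?thesis
      by (simp add: w(2) flip: w_def) (simp add: w(1) mult.assoc)
  qed (simp add: F_def half_plane_kernel_def Complex_eq_0)
  have "((\<lambda>s. - (1 / 2) * (F (Complex 0 s) + F (Complex 0 (- s)))) has_integral - (1 / 2) * I) {0..R}"
    using \<open>R \<ge> 2\<close> by (intro has_integral_mult_right has_integral_symmetrize[OF I]) auto
  then have "((\<lambda>s. of_real (half_plane_kernel s) *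
      ((\<Phi> (Complex 0 s) - \<Phi> (Complex 0 (- s))) / (2 * \<i> * of_real s) - d)) has_integral - (1 / 2) * I) {0..R}"
    by (simp add: sym)
  moreover have "norm (- (1 / 2) * I) \<le> 4 * pi * C / R"
    using nI \<open>R \<ge> 2\<close> by (simp add: norm_mult norm_divide field_simps power2_eq_square)
  ultimately show ?thesis
    using that unfolding C_def d_def by blast
qed

section \<open>The reproducing formula on the half line\<close>

lemma set_integrable_half_plane_kernel: "set_integrable lborel {0..} half_plane_kernel"
  using has_bochner_integral_half_plane_kernel
  by (simp add: set_integrable_def has_bochner_integral_iff)

lemma set_integral_half_plane_kernel: "(LINT s:{0..}|lborel. half_plane_kernel s) = pi / 4"
  using has_bochner_integral_half_plane_kernel
  by (simp add: set_lebesgue_integral_def has_bochner_integral_iff)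

lemma half_plane_kernel_le_1: "half_plane_kernel s \<le> 1"
proof -
  have "s\<^sup>2 \<le> (1 + s\<^sup>2)\<^sup>2"
    by (simp add: power2_sum)
  then show ?thesis
    unfolding half_plane_kernel_def by (intro divide_le_eq_1[THEN iffD2]) (auto simp: sum_power2_gt_zero_iff)
qed

text \<open>The average over \<open>{y - s..y + s}\<close> of the boundary values of the derivative
  of \<Phi>; the factor \<open>\<i>\<close> comes from \<open>dz = \<i> dt\<close>. Division by zero
  makes it 0 at \<open>s = 0\<close>, in keeping with the bound by the Lipschitz constant.\<close>

definition boundary_quotient :: "(complex \<Rightarrow> complex) \<Rightarrow> real \<Rightarrow> real \<Rightarrow> complex" where
  "boundary_quotient \<Phi> y s =
     (\<Phi> (Complex 0 (y + s)) - \<Phi> (Complex 0 (y - s))) / (2 * \<i> * of_real s)"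

lemma norm_boundary_quotient_le:
  assumes lip: "L-lipschitz_on {z. Re z \<ge> 0} \<Phi>"
  shows "norm (boundary_quotient \<Phi> y s) \<le> L"
proof (cases "s = 0")
  case True
  then show ?thesis
    using lipschitz_on_nonneg[OF lip] by (simp add: boundary_quotient_def)
next
  case False
  have "Complex 0 (y + s) - Complex 0 (y - s) = 2 * \<i> * of_real s"
    by (simp add: complex_eq_iff)
  then have "norm (\<Phi> (Complex 0 (y + s)) - \<Phi> (Complex 0 (y - s))) \<le> L * norm (2 * \<i> * of_real s)"
    using lipschitz_onD[OF lip, of "Complex 0 (y + s)" "Complex 0 (y - s)"] by (simp add: dist_norm)
  then show ?thesis
    using False by (simp add: boundary_quotient_def norm_divide divide_le_eq norm_mult)
qed

lemma borel_measurable_boundary_quotient: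
  assumes lip: "L-lipschitz_on {z. Re z \<ge> 0} \<Phi>"
  shows "boundary_quotient \<Phi> y \<in> borel_measurable borel"
proof -
  have [measurable]: "(\<lambda>t. \<Phi> (Complex 0 t)) \<in> borel_measurable borel"
    unfolding Complex_eq
    by (intro borel_measurable_continuous_onI continuous_on_compose2[OF lipschitz_on_continuous_on[OF lip]]
        continuous_intros) auto
  show ?thesis
    unfolding boundary_quotient_def by measurable
qed

lemma set_integrable_kernel_boundary_quotient:
  assumes lip: "L-lipschitz_on {z. Re z \<ge> 0} \<Phi>"
  shows "set_integrable lborel {0..} (\<lambda>s. of_real (half_plane_kernel s) * boundary_quotient \<Phi> y (x * s))"
proof (rule set_integrable_bound)
  show "set_integrable lborel {0..} (\<lambda>s. L * half_plane_kernel s)"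
    using set_integrable_half_plane_kernel by simp
  note [measurable] = borel_measurable_boundary_quotient[OF lip]
  show "set_borel_measurable lborel {0..} (\<lambda>s. of_real (half_plane_kernel s) * boundary_quotient \<Phi> y (x * s))"
    unfolding set_borel_measurable_def by measurable
  show "AE s in lborel. s \<in> {0..} \<longrightarrow>
      norm (of_real (half_plane_kernel s) * boundary_quotient \<Phi> y (x * s)) \<le> norm (L * half_plane_kernel s)"
    using norm_boundary_quotient_le[OF lip] lipschitz_on_nonneg[OF lip]
    by (intro AE_I2) (auto simp: norm_mult half_plane_kernel_nonneg mult.commute[of L] mult_left_mono)
qed

text \<open>Let \<open>R\<close> tend to infinity in the truncated formula: its error is of order
  \<open>1 / R\<close>, while integrability makes the truncated integrals converge to the full one.
  The mass \<open>pi / 4\<close> of the kernel produces the constant.\<close>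

lemma deriv_eq_kernel_integral_at_1:
  assumes holo: "\<Phi> holomorphic_on {z. Re z > 0}" and lip: "L-lipschitz_on {z. Re z \<ge> 0} \<Phi>"
  shows "(LINT s:{0..}|lborel. of_real (half_plane_kernel s) * boundary_quotient \<Phi> 0 s) =
    of_real (pi / 4) * deriv \<Phi> 1"
proof -
  let ?f = "\<lambda>s. of_real (half_plane_kernel s) * boundary_quotient \<Phi> 0 s"
  let ?g = "\<lambda>s. of_real (half_plane_kernel s) * deriv \<Phi> 1"
  have intf: "set_integrable lborel {0..} ?f"
    using set_integrable_kernel_boundary_quotient[OF lip, of 0 1] by simp
  have "set_integrable lborel {0..} (\<lambda>s. complex_of_real (half_plane_kernel s))"
    using set_integrable_half_plane_kernel[unfolded set_integrable_def, THEN integrable_of_real, where 'a = complex]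
    by (simp add: set_integrable_def scaleR_conv_of_real)
  then have intg: "set_integrable lborel {0..} ?g"
    by simp
  have int: "set_integrable lborel {0..} (\<lambda>s. ?f s - ?g s)"
    using intf intg by (rule set_integral_diff)
  have "((\<lambda>R. LINT s:{0..R}|lborel. ?f s - ?g s) \<longlongrightarrow> 0) at_top"
  proof (rule tendsto_norm_zero_cancel, rule tendsto_sandwich[OF _ _ tendsto_const])
    show "((\<lambda>R. 4 * pi * (L + norm (deriv \<Phi> 1)) / R) \<longlongrightarrow> 0) at_top"
      by (rule real_tendsto_divide_at_top[OF tendsto_const filterlim_ident])
    show "eventually (\<lambda>R. norm (LINT s:{0..R}|lborel. ?f s - ?g s) \<le> 4 * pi * (L + norm (deriv \<Phi> 1)) / R) at_top"
      using eventually_ge_at_top[of 2]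
    proof eventually_elim
      case (elim R)
      obtain I where I: "((\<lambda>s. of_real (half_plane_kernel s) *
          ((\<Phi> (Complex 0 s) - \<Phi> (Complex 0 (- s))) / (2 * \<i> * of_real s) - deriv \<Phi> 1)) has_integral I) {0..R}"
        "norm I \<le> 4 * pi * (L + norm (deriv \<Phi> 1)) / R"
        using half_plane_kernel_truncated[OF holo lip elim] by blast
      have "set_integrable lborel {0..R} (\<lambda>s. ?f s - ?g s)"
        using int by (rule set_integrable_subset) auto
      then have "(LINT s:{0..R}|lborel. ?f s - ?g s) = integral {0..R} (\<lambda>s. ?f s - ?g s)"
        by (rule set_borel_integral_eq_integral)
      also have "\<dots> = integral {0..R} (\<lambda>s. of_real (half_plane_kernel s) *
          ((\<Phi> (Complex 0 s) - \<Phi> (Complex 0 (- s))) / (2 * \<i> * of_real s) - deriv \<Phi> 1))"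
        by (simp add: boundary_quotient_def right_diff_distrib)
      finally show ?case
        using I by (simp only: integral_unique)
    qed
  qed auto
  moreover have "((\<lambda>R. LINT s:{0..R}|lborel. ?f s - ?g s) \<longlongrightarrow> (LINT s:{0..}|lborel. ?f s - ?g s)) at_top"
    using int by (intro tendsto_set_lebesgue_integral_at_top) auto
  ultimately have "(LINT s:{0..}|lborel. ?f s - ?g s) = 0"
    using tendsto_unique[OF trivial_limit_at_top_linorder] by blast
  then have "(LINT s:{0..}|lborel. ?f s) = (LINT s:{0..}|lborel. ?g s)"
    using set_integral_diff(2)[OF intf intg] by simp
  also have "\<dots> = of_real (pi / 4) * deriv \<Phi> 1"
    by (simp add: set_integral_half_plane_kernel set_integral_complex_of_real)
  finally show ?thesis .
qed

text \<open>The affine map \<open>T\<close> preserves the half plane and sends 1 to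
  \<open>Complex x y\<close>. Dividing by \<open>x\<close> in \<open>\<Psi>\<close> undoes the
  dilation, so the Lipschitz constant is still \<open>L\<close> and the derivative of
  \<open>\<Psi>\<close> at 1 is the one sought.\<close>

lemma deriv_eq_kernel_integral:
  assumes holo: "\<Phi> holomorphic_on {z. Re z > 0}" and lip: "L-lipschitz_on {z. Re z \<ge> 0} \<Phi>"
    and "x > 0"
  shows "(LINT s:{0..}|lborel. of_real (half_plane_kernel s) * boundary_quotient \<Phi> y (x * s)) =
    of_real (pi / 4) * deriv \<Phi> (Complex x y)"
proof -
  define T where "T = (\<lambda>w. Complex 0 y + of_real x * w)"
  define \<Psi> where "\<Psi> = (\<lambda>w. \<Phi> (T w) / of_real x)"
  have T_holo: "T holomorphic_on A" for A
    unfolding T_def by (intro holomorphic_intros)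
  have "\<Psi> holomorphic_on {z. Re z > 0}"
    unfolding \<Psi>_def using \<open>x > 0\<close>
    by (intro holomorphic_intros holomorphic_on_compose_gen[OF T_holo holo, unfolded o_def]) (auto simp: T_def)
  moreover have "L-lipschitz_on {z. Re z \<ge> 0} \<Psi>"
  proof (rule lipschitz_onI)
    fix z w :: complex assume zw: "z \<in> {z. Re z \<ge> 0}" "w \<in> {z. Re z \<ge> 0}"
    have "dist (\<Phi> (T z)) (\<Phi> (T w)) \<le> L * dist (T z) (T w)"
      using zw \<open>x > 0\<close> by (intro lipschitz_onD[OF lip]) (auto simp: T_def)
    also have "dist (T z) (T w) = x * dist z w"
      using \<open>x > 0\<close> by (simp add: T_def dist_norm norm_mult flip: right_diff_distrib)
    finally show "dist (\<Psi> z) (\<Psi> w) \<le> L * dist z w"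
      using \<open>x > 0\<close> by (simp add: \<Psi>_def dist_norm norm_divide divide_le_eq mult_ac flip: diff_divide_distrib)
  qed (rule lipschitz_on_nonneg[OF lip])
  ultimately have "(LINT s:{0..}|lborel. of_real (half_plane_kernel s) * boundary_quotient \<Psi> 0 s) =
      of_real (pi / 4) * deriv \<Psi> 1"
    by (rule deriv_eq_kernel_integral_at_1)
  moreover have "boundary_quotient \<Psi> 0 s = boundary_quotient \<Phi> y (x * s)" for s
  proof -
    have "T (Complex 0 s) = Complex 0 (y + x * s)" "T (Complex 0 (- s)) = Complex 0 (y - x * s)"
      by (auto simp: T_def complex_eq_iff)
    then show ?thesis
      using \<open>x > 0\<close> by (simp add: boundary_quotient_def \<Psi>_def field_simps)
  qed
  moreover have "deriv \<Psi> 1 = deriv \<Phi> (Complex x y)"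
  proof (rule DERIV_imp_deriv)
    have T1: "T 1 = Complex x y" by (simp add: T_def complex_eq_iff)
    have "(\<Phi> has_field_derivative deriv \<Phi> (T 1)) (at (T 1))"
      using holo \<open>x > 0\<close> by (intro holomorphic_derivI[OF holo open_halfspace_Re_gt]) (simp add: T1)
    moreover have "(T has_field_derivative of_real x) (at 1)"
      unfolding T_def by (auto intro!: derivative_eq_intros)
    ultimately have "((\<lambda>w. \<Phi> (T w)) has_field_derivative deriv \<Phi> (T 1) * of_real x) (at 1)"
      by (rule DERIV_chain2)
    then have "(\<Psi> has_field_derivative deriv \<Phi> (T 1) * of_real x / of_real x) (at 1)"
      unfolding \<Psi>_def by (rule DERIV_cdivide)
    then show "(\<Psi> has_field_derivative deriv \<Phi> (Complex x y)) (at 1)"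
      using \<open>x > 0\<close> by (simp add: T1)
  qed
  ultimately show ?thesis by simp
qed

text \<open>For fixed \<open>s > 0\<close> the quotient at \<open>x * s\<close> tends to
  \<open>l\<close> as \<open>x\<close> tends to 0. Dominated convergence with majorant
  \<open>L\<close> times the kernel passes this limit through the reproducing formula.\<close>

lemma deriv_tendsto_boundary:
  assumes holo: "\<Phi> holomorphic_on {z. Re z > 0}" and lip: "L-lipschitz_on {z. Re z \<ge> 0} \<Phi>"
    and lim: "(boundary_quotient \<Phi> y \<longlongrightarrow> l) (at_right 0)"
  shows "((\<lambda>x. deriv \<Phi> (Complex x y)) \<longlongrightarrow> l) (at_right 0)"
proof (rule tendsto_at_right_sequentially[of 0 1])
  fix S :: "nat \<Rightarrow> real" assume S: "\<And>n. 0 < S n" "S \<longlonglongrightarrow> 0"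
  note [measurable] = borel_measurable_boundary_quotient[OF lip]
  \<comment> \<open>The point \<open>s = 0\<close> is left out because \<open>S n * s\<close> must
    approach 0 through positive values; being null, it is put back afterwards.\<close>
  have "(\<lambda>n. \<integral>s. indicator {0<..} s *\<^sub>R (of_real (half_plane_kernel s) * boundary_quotient \<Phi> y (S n * s)) \<partial>lborel) \<longlonglongrightarrow>
      (\<integral>s. indicator {0<..} s *\<^sub>R (of_real (half_plane_kernel s) * l) \<partial>lborel)"
  proof (rule integral_dominated_convergence)
    show "integrable lborel (\<lambda>s. L * (indicator {0..} s *\<^sub>R half_plane_kernel s))"
      using set_integrable_half_plane_kernel by (simp add: set_integrable_def)
    show "AE s in lborel. (\<lambda>n. indicator {0<..} s *\<^sub>R (of_real (half_plane_kernel s) * boundary_quotient \<Phi> y (S n * s)))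
        \<longlonglongrightarrow> indicator {0<..} s *\<^sub>R (of_real (half_plane_kernel s) * l)"
    proof (intro AE_I2)
      fix s :: real
      show "(\<lambda>n. indicator {0<..} s *\<^sub>R (of_real (half_plane_kernel s) * boundary_quotient \<Phi> y (S n * s)))
        \<longlonglongrightarrow> indicator {0<..} s *\<^sub>R (of_real (half_plane_kernel s) * l)"
      proof (cases "s > 0")
        case True
        have "S n \<noteq> 0" for n
          using S(1)[of n] by simp
        then have "filterlim (\<lambda>n. S n * s) (at_right 0) sequentially"
          using S True by (auto simp: filterlim_at intro!: tendsto_mult_left_zero)
        then have "(\<lambda>n. boundary_quotient \<Phi> y (S n * s)) \<longlonglongrightarrow> l"
          by (rule filterlim_compose[OF lim])
        then show ?thesis by (intro tendsto_intros)
      qed simp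
    qed
    show "AE s in lborel. norm (indicator {0<..} s *\<^sub>R (of_real (half_plane_kernel s) * boundary_quotient \<Phi> y (S n * s)))
        \<le> L * (indicator {0..} s *\<^sub>R half_plane_kernel s)" for n
      using norm_boundary_quotient_le[OF lip] lipschitz_on_nonneg[OF lip] half_plane_kernel_nonneg
      by (intro AE_I2) (auto simp: norm_mult indicator_def mult.commute[of L] mult_left_mono)
  qed measurable
  moreover have ae: "AE s in lborel. s \<noteq> (0::real)"
    by (rule AE_lborel_singleton)
  have "(\<integral>s. indicator {0<..} s *\<^sub>R f s \<partial>lborel) = (LINT s:{0..}|lborel. f s)"
    if [measurable]: "f \<in> borel_measurable borel" for f :: "real \<Rightarrow> complex"
    unfolding set_lebesgue_integral_def using ae
    by (intro integral_cong_AE) (auto simp: indicator_def)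
  ultimately have "(\<lambda>n. of_real (pi / 4) * deriv \<Phi> (Complex (S n) y)) \<longlonglongrightarrow>
      (LINT s:{0..}|lborel. of_real (half_plane_kernel s) * l)"
    using deriv_eq_kernel_integral[OF holo lip S(1)] by simp
  also have "(LINT s:{0..}|lborel. of_real (half_plane_kernel s) * l) = of_real (pi / 4) * l"
    by (simp add: set_integral_complex_of_real set_integral_half_plane_kernel)
  finally have "(\<lambda>n. of_real (4 / pi) * (of_real (pi / 4) * deriv \<Phi> (Complex (S n) y))) \<longlonglongrightarrow>
      of_real (4 / pi) * (of_real (pi / 4) * l)"
    by (rule tendsto_mult_left)
  moreover have "of_real (4 / pi) * (of_real (pi / 4) * z) = z" for z :: complex
    by (simp flip: mult.assoc of_real_mult)
  ultimately show "(\<lambda>n. deriv \<Phi> (Complex (S n) y)) \<longlonglongrightarrow> l"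
    by (simp only:)
qed simp
section \<open>Averages on the boundary and suprema on vertical lines\<close>

text \<open>Lipschitz continuity on the closed half plane gives \<Phi> its values on the imaginary
  axis, so averages can be compared through \<Phi> before boundary limits of \<phi> are known to
  exist.\<close>

locale half_plane_primitive =
  fixes \<Phi> \<phi> :: "complex \<Rightarrow> complex" and M :: real
  assumes lip: "M-lipschitz_on {z. Re z \<ge> 0} \<Phi>"
    and deriv: "\<And>z. Re z > 0 \<Longrightarrow> (\<Phi> has_field_derivative \<phi> z) (at z)"
begin

lemma M_nonneg: "M \<ge> 0"
  using lip by (rule lipschitz_on_nonneg)

lemma holo: "\<Phi> holomorphic_on {z. Re z > 0}"
  using deriv by (auto simp: holomorphic_on_open[OF open_halfspace_Re_gt])

lemma deriv_eq: "Re z > 0 \<Longrightarrow> deriv \<Phi> z = \<phi> z"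
  using deriv by (rule DERIV_imp_deriv)

lemma holo_deriv: "\<phi> holomorphic_on {z. Re z > 0}"
proof -
  have "deriv \<Phi> holomorphic_on {z. Re z > 0}"
    by (rule holomorphic_deriv[OF holo open_halfspace_Re_gt])
  then show ?thesis
    by (rule holomorphic_transform) (simp add: deriv_eq)
qed

lemma lipschitz_horizontal:
  assumes "x \<ge> 0"
  shows "norm (\<Phi> (Complex x t) - \<Phi> (Complex 0 t)) \<le> M * x"
proof -
  have "Complex x t - Complex 0 t = of_real x"
    by (simp add: complex_eq_iff)
  then show ?thesis
    using lipschitz_onD[OF lip, of "Complex x t" "Complex 0 t"] assms by (simp add: dist_norm)
qed

lemma vertical_derivative:
  assumes "x > 0"
  shows "((\<lambda>t. \<Phi> (Complex x t) / \<i>) has_vector_derivative \<phi> (Complex x t)) (at t within A)"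
proof -
  have "((\<lambda>t. Complex x t) has_vector_derivative \<i>) (at t within A)"
    unfolding Complex_eq by (auto intro!: derivative_eq_intros)
  from field_vector_diff_chain_within[OF this has_field_derivative_at_within[OF deriv]]
  have "((\<lambda>t. \<Phi> (Complex x t)) has_vector_derivative \<i> * \<phi> (Complex x t)) (at t within A)"
    using assms by (simp add: o_def)
  from has_vector_derivative_mult_left[OF this, of "- \<i>"] show ?thesis
    by (simp add: mult_ac)
qed

text \<open>An average along the line \<open>Re z = x\<close> is at most \<open>b\<close>. Moving
  the two end points to the imaginary axis costs \<open>M * x\<close> each, and division by
  \<open>2 * \<theta>\<close> gives the error.\<close>

lemma Re_boundary_quotient_le:
  assumes "x > 0" "\<theta> > 0" and bound: "\<And>t. Re (\<phi> (Complex x t)) \<le> b"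
  shows "Re (boundary_quotient \<Phi> y \<theta>) \<le> b + M * x / \<theta>"
proof -
  define h where "h = (\<lambda>t. Re (\<Phi> (Complex x t) / \<i>))"
  have "(h has_real_derivative Re (\<phi> (Complex x t))) (at t)" for t
    unfolding h_def has_real_derivative_iff_has_vector_derivative
    using vertical_derivative[OF \<open>x > 0\<close>]
    by (rule bounded_linear.has_vector_derivative[OF bounded_linear_Re])
  \<comment> \<open>The average is bounded by monotonicity of \<open>b * t - h t\<close>, with no
    integral on the line \<open>Re z = x\<close>.\<close>
  then have "((\<lambda>t. b * t - h t) has_real_derivative b - Re (\<phi> (Complex x t))) (at t)" for t
    by (auto intro!: derivative_eq_intros)
  then have "b * (y - \<theta>) - h (y - \<theta>) \<le> b * (y + \<theta>) - h (y + \<theta>)"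
    using bound \<open>\<theta> > 0\<close> by (intro DERIV_nonneg_imp_nondecreasing[where f = "\<lambda>t. b * t - h t"]) force+
  then have 1: "h (y + \<theta>) - h (y - \<theta>) \<le> b * (2 * \<theta>)"
    by (simp add: algebra_simps)
  have 2: "\<bar>Re (\<Phi> (Complex 0 t) / \<i>) - h t\<bar> \<le> M * x" for t
  proof -
    have "\<bar>Re (\<Phi> (Complex 0 t) / \<i>) - h t\<bar> = \<bar>Re ((\<Phi> (Complex x t) - \<Phi> (Complex 0 t)) / \<i>)\<bar>"
      by (simp add: h_def)
    also have "\<dots> \<le> norm ((\<Phi> (Complex x t) - \<Phi> (Complex 0 t)) / \<i>)"
      by (rule abs_Re_le_cmod)
    also have "\<dots> \<le> M * x"
      using lipschitz_horizontal[of x t] \<open>x > 0\<close> by (simp add: norm_mult)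
    finally show ?thesis .
  qed
  have "Re (boundary_quotient \<Phi> y \<theta>) =
      (Re (\<Phi> (Complex 0 (y + \<theta>)) / \<i>) - Re (\<Phi> (Complex 0 (y - \<theta>)) / \<i>)) / (2 * \<theta>)"
  proof -
    have "boundary_quotient \<Phi> y \<theta> =
        (\<Phi> (Complex 0 (y + \<theta>)) / \<i> - \<Phi> (Complex 0 (y - \<theta>)) / \<i>) / of_real (2 * \<theta>)"
      using \<open>\<theta> > 0\<close> by (simp add: boundary_quotient_def field_simps)
    then show ?thesis
      by (simp only: Re_divide_of_real minus_complex.sel)
  qed
  also have "\<dots> \<le> (b * (2 * \<theta>) + 2 * (M * x)) / (2 * \<theta>)"
    using 1 2[of "y + \<theta>"] 2[of "y - \<theta>"] \<open>\<theta> > 0\<close> by (intro divide_right_mono) auto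
  also have "\<dots> = b + M * x / \<theta>"
    using \<open>\<theta> > 0\<close> by (simp add: field_simps)
  finally show ?thesis .
qed

text \<open>In the reproducing formula the averages have length parameter \<open>x * s\<close>. For
  \<open>s > \<Theta> / x\<close> they are at most \<open>a\<close>; on the remaining interval of
  length \<open>\<Theta> / x\<close> they exceed \<open>a\<close> by at most
  \<open>M + \<bar>a\<bar>\<close>, and the kernel is at most 1.\<close>

lemma Re_le_boundary_quotient:
  assumes "x > 0" "\<Theta> > 0" and bound: "\<And>\<theta>. \<theta> \<ge> \<Theta> \<Longrightarrow> Re (boundary_quotient \<Phi> y \<theta>) \<le> a"
  shows "Re (\<phi> (Complex x y)) \<le> a + 4 / pi * ((M + \<bar>a\<bar>) * (\<Theta> / x))"
proof -
  let ?k = "half_plane_kernel"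
  let ?I = "\<lambda>s. indicator {0..} s *\<^sub>R (of_real (?k s) * boundary_quotient \<Phi> y (x * s))"
  have int: "integrable lborel ?I"
    using set_integrable_kernel_boundary_quotient[OF lip] by (simp add: set_integrable_def)
  have int1: "integrable lborel (\<lambda>s. a * (indicator {0..} s *\<^sub>R ?k s))"
    using set_integrable_half_plane_kernel[unfolded set_integrable_def] by (intro integrable_mult_right) auto
  have int2: "integrable lborel (\<lambda>s. (M + \<bar>a\<bar>) * indicator {0..\<Theta> / x} s)"
    using \<open>x > 0\<close> \<open>\<Theta> > 0\<close> by (intro integrable_mult_right integrable_real_indicator) auto
  have "(\<integral>s. ?I s \<partial>lborel) = of_real (pi / 4) * \<phi> (Complex x y)"
    using deriv_eq_kernel_integral[OF holo lip \<open>x > 0\<close>, of y] \<open>x > 0\<close>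
    by (simp only: deriv_eq set_lebesgue_integral_def complex.sel)
  then have "pi / 4 * Re (\<phi> (Complex x y)) = Re (\<integral>s. ?I s \<partial>lborel)"
    by (simp only: times_complex.sel Re_complex_of_real Im_complex_of_real)
  also have "\<dots> = (\<integral>s. Re (?I s) \<partial>lborel)"
    using int by (rule integral_Re[symmetric])
  also have "\<dots> \<le> (\<integral>s. a * (indicator {0..} s *\<^sub>R ?k s) + (M + \<bar>a\<bar>) * indicator {0..\<Theta> / x} s \<partial>lborel)"
  proof (rule integral_mono)
    show "integrable lborel (\<lambda>s. a * (indicator {0..} s *\<^sub>R ?k s) + (M + \<bar>a\<bar>) * indicator {0..\<Theta> / x} s)"
      using int1 int2 by (rule Bochner_Integration.integrable_add)
    fix s :: real
    show "Re (?I s) \<le> a * (indicator {0..} s *\<^sub>R ?k s) + (M + \<bar>a\<bar>) * indicator {0..\<Theta> / x} s"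
    proof (cases "s \<in> {0..\<Theta> / x}")
      case True
      have "Re (boundary_quotient \<Phi> y (x * s)) \<le> M"
        using complex_Re_le_cmod norm_boundary_quotient_le[OF lip] by (rule order_trans)
      then have "?k s * (Re (boundary_quotient \<Phi> y (x * s)) - a) \<le> ?k s * (M + \<bar>a\<bar>)"
        using half_plane_kernel_nonneg by (intro mult_left_mono) auto
      also have "\<dots> \<le> 1 * (M + \<bar>a\<bar>)"
        using half_plane_kernel_le_1 M_nonneg by (intro mult_right_mono) auto
      finally show ?thesis
        using True by (simp add: algebra_simps)
    next
      case False
      then consider "s < 0" | "s > \<Theta> / x" by fastforce
      then show ?thesis
      proof cases
        case 2
        then have "x * s \<ge> \<Theta>" "s \<ge> 0"
          using \<open>x > 0\<close> \<open>\<Theta> > 0\<close> by (auto simp: field_simps less_imp_le[OF order.strict_trans[OF divide_pos_pos]])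
        then show ?thesis
          using 2 mult_left_mono[OF bound half_plane_kernel_nonneg, of "x * s" s]
          by (simp add: mult.commute)
      qed (use \<open>\<Theta> > 0\<close> in simp)
    qed
  qed (use int in \<open>rule integrable_Re\<close>)
  also have "\<dots> = a * (\<integral>s. indicator {0..} s *\<^sub>R ?k s \<partial>lborel) + (M + \<bar>a\<bar>) * (\<integral>s. indicator {0..\<Theta> / x} s \<partial>lborel)"
    by (subst Bochner_Integration.integral_add[OF int1 int2]) simp
  also have "\<dots> = a * (pi / 4) + (M + \<bar>a\<bar>) * (\<Theta> / x)"
    using set_integral_half_plane_kernel \<open>x > 0\<close> \<open>\<Theta> > 0\<close> by (simp add: set_lebesgue_integral_def)
  finally have "4 / pi * (pi / 4 * Re (\<phi> (Complex x y))) \<le> 4 / pi * (a * (pi / 4) + (M + \<bar>a\<bar>) * (\<Theta> / x))"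
    by (intro mult_left_mono) auto
  then show ?thesis
    by (simp add: distrib_left)
qed

text \<open>Each inequality fixes one parameter and sends the other to infinity, so that the error
  \<open>M * x / \<theta>\<close>, or the one proportional to \<open>\<Theta> / x\<close>,
  disappears.\<close>

lemma Limsup_boundary_quotient:
  "Limsup at_top (\<lambda>\<theta>. SUP y. ereal (Re (boundary_quotient \<Phi> y \<theta>))) =
   Limsup at_top (\<lambda>x. SUP y. ereal (Re (\<phi> (Complex x y))))" (is "Limsup _ ?A = Limsup _ ?B")
proof (rule antisym)
  show "Limsup at_top ?A \<le> Limsup at_top ?B"
  proof (rule dense_ge)
    fix e assume e: "Limsup at_top ?B < e"
    show "Limsup at_top ?A \<le> e"
    proof (cases e)
      case (real b)
      have "eventually (\<lambda>x. ?B x < e) at_top"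
        using e by (rule Limsup_lessD)
      then have "eventually (\<lambda>x. ?B x < e \<and> x > 0) at_top"
        using eventually_gt_at_top by (rule eventually_conj)
      \<comment> \<open>A single vertical line with supremum below \<open>e\<close> is enough, since
        only \<theta> grows from here on.\<close>
      then obtain x where x: "?B x < e" "x > 0"
        by (auto dest: eventually_happens)
      have b: "Re (\<phi> (Complex x t)) \<le> b" for t
        using SUP_lessD[OF x(1), of t] real by simp
      have "Limsup at_top ?A \<le> Limsup at_top (\<lambda>\<theta>. ereal (b + M * x / \<theta>))"
      proof (rule Limsup_mono)
        show "eventually (\<lambda>\<theta>. ?A \<theta> \<le> ereal (b + M * x / \<theta>)) at_top"
          using eventually_gt_at_top[of 0]
          by eventually_elim (auto intro!: SUP_least Re_boundary_quotient_le x b)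
      qed
      also have "Limsup at_top (\<lambda>\<theta>. ereal (b + M * x / \<theta>)) = ereal (b + 0)"
        by (intro lim_imp_Limsup tendsto_intros real_tendsto_divide_at_top[OF tendsto_const] filterlim_ident) auto
      finally show ?thesis using real by simp
    qed (use e in auto)
  qed
next
  show "Limsup at_top ?B \<le> Limsup at_top ?A"
  proof (rule dense_ge)
    fix e assume e: "Limsup at_top ?A < e"
    show "Limsup at_top ?B \<le> e"
    proof (cases e)
      case (real a)
      have "eventually (\<lambda>\<theta>. ?A \<theta> < e) at_top"
        using e by (rule Limsup_lessD)
      then obtain \<Theta>0 where "\<And>\<theta>. \<theta> \<ge> \<Theta>0 \<Longrightarrow> ?A \<theta> < e"
        by (auto simp: eventually_at_top_linorder)
      \<comment> \<open>The maximum with 1 makes the threshold positive.\<close>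
      then have a: "Re (boundary_quotient \<Phi> y \<theta>) \<le> a" if "\<theta> \<ge> max 1 \<Theta>0" for \<theta> y
        using SUP_lessD[of _ UNIV e y] that real by fastforce
      let ?K = "(M + \<bar>a\<bar>) * max 1 \<Theta>0"
      have "Limsup at_top ?B \<le> Limsup at_top (\<lambda>x. ereal (a + 4 / pi * (?K / x)))"
      proof (rule Limsup_mono)
        show "eventually (\<lambda>x. ?B x \<le> ereal (a + 4 / pi * (?K / x))) at_top"
          using eventually_gt_at_top[of 0]
        proof eventually_elim
          case (elim x)
          then show ?case
            using Re_le_boundary_quotient[of x "max 1 \<Theta>0" _ a] a by (auto intro!: SUP_least)
        qed
      qed
      also have "Limsup at_top (\<lambda>x. ereal (a + 4 / pi * (?K / x))) = ereal (a + 4 / pi * 0)"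
        by (intro lim_imp_Limsup tendsto_intros real_tendsto_divide_at_top[OF tendsto_const] filterlim_ident) auto
      finally show ?thesis using real by simp
    qed (use e in auto)
  qed
qed

section \<open>Imaginary parts and infima by rotation\<close>

text \<open>Multiplication by \<open>- \<i>\<close> turns imaginary parts into real parts, and
  multiplication by \<open>- 1\<close> exchanges suprema with infima, so the first equality yields
  the other three.\<close>

lemma scale:
  assumes "norm c = 1"
  shows "half_plane_primitive (\<lambda>z. c * \<Phi> z) (\<lambda>z. c * \<phi> z) M"
proof
  show "M-lipschitz_on {z. Re z \<ge> 0} (\<lambda>z. c * \<Phi> z)"
    using lip assms by (auto simp: lipschitz_on_def dist_norm norm_mult simp flip: right_diff_distrib)
  show "((\<lambda>z. c * \<Phi> z) has_field_derivative c * \<phi> z) (at z)" if "Re z > 0" for z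
    using deriv[OF that] by (rule DERIV_cmult)
qed

lemma boundary_quotient_scale:
  "boundary_quotient (\<lambda>z. c * \<Phi> z) y s = c * boundary_quotient \<Phi> y s"
  by (simp add: boundary_quotient_def right_diff_distrib)

lemma Limsup_Im_boundary_quotient:
  "Limsup at_top (\<lambda>\<theta>. SUP y. ereal (Im (boundary_quotient \<Phi> y \<theta>))) =
   Limsup at_top (\<lambda>x. SUP y. ereal (Im (\<phi> (Complex x y))))"
proof -
  interpret s: half_plane_primitive "\<lambda>z. - \<i> * \<Phi> z" "\<lambda>z. - \<i> * \<phi> z" M
    by (rule scale) simp
  have "Re (- \<i> * w) = Im w" for w
    by simp
  then show ?thesis
    using s.Limsup_boundary_quotient by (simp only: boundary_quotient_scale)
qed

lemma Liminf_boundary_quotient: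
  "Liminf at_top (\<lambda>\<theta>. INF y. ereal (Re (boundary_quotient \<Phi> y \<theta>))) =
   Liminf at_top (\<lambda>x. INF y. ereal (Re (\<phi> (Complex x y))))"
proof -
  interpret s: half_plane_primitive "\<lambda>z. (- 1) * \<Phi> z" "\<lambda>z. (- 1) * \<phi> z" M
    by (rule scale) simp
  show ?thesis
    using s.Limsup_boundary_quotient unfolding boundary_quotient_scale
    by (simp only: mult_minus1 uminus_complex.sel uminus_ereal.simps(1)[symmetric] ereal_SUP_uminus_eq
        ereal_Limsup_uminus ereal_uminus_eq_iff)
qed

lemma Liminf_Im_boundary_quotient:
  "Liminf at_top (\<lambda>\<theta>. INF y. ereal (Im (boundary_quotient \<Phi> y \<theta>))) =
   Liminf at_top (\<lambda>x. INF y. ereal (Im (\<phi> (Complex x y))))"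
proof -
  interpret s: half_plane_primitive "\<lambda>z. (- 1) * \<Phi> z" "\<lambda>z. (- 1) * \<phi> z" M
    by (rule scale) simp
  show ?thesis
    using s.Limsup_Im_boundary_quotient unfolding boundary_quotient_scale
    by (simp only: mult_minus1 uminus_complex.sel uminus_ereal.simps(1)[symmetric] ereal_SUP_uminus_eq
        ereal_Limsup_uminus ereal_uminus_eq_iff)
qed


section \<open>Fatou's theorem\<close>

text \<open>The real and imaginary parts of \<Phi> on the imaginary axis are Lipschitz functions of
  one real variable, so their symmetric derivatives exist simultaneously at almost every
  point.\<close>

lemma AE_boundary_quotient_tendsto: "AE y in lborel. \<exists>l. (boundary_quotient \<Phi> y \<longlongrightarrow> l) (at_right 0)"
proof -
  let ?g = "\<lambda>t. \<Phi> (Complex 0 t)"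
  have "dist (?g s) (?g t) \<le> M * dist s t" for s t
  proof -
    have "Complex 0 s - Complex 0 t = \<i> * of_real (s - t)"
      by (simp add: complex_eq_iff)
    then show ?thesis
      using lipschitz_onD[OF lip, of "Complex 0 s" "Complex 0 t"]
      by (simp add: dist_norm norm_mult flip: of_real_diff)
  qed
  then have g: "norm (?g s - ?g t) \<le> M * \<bar>s - t\<bar>" for s t
    by (simp add: dist_norm)
  have "M-lipschitz_on UNIV (\<lambda>t. Re (?g t))" "M-lipschitz_on UNIV (\<lambda>t. Im (?g t))"
    using abs_Re_le_cmod[THEN order_trans, OF g] abs_Im_le_cmod[THEN order_trans, OF g] M_nonneg
    by (auto simp: lipschitz_on_def dist_real_def)
  from this[THEN lipschitz_AE_symmetric_derivative] show ?thesis
  proof eventually_elim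
    case (elim y)
    then obtain a b where
      "((\<lambda>s. (Re (?g (y + s)) - Re (?g (y - s))) / (2 * s)) \<longlongrightarrow> a) (at_right 0)"
      "((\<lambda>s. (Im (?g (y + s)) - Im (?g (y - s))) / (2 * s)) \<longlongrightarrow> b) (at_right 0)"
      by auto
    then have "((\<lambda>s. Complex ((Re (?g (y + s)) - Re (?g (y - s))) / (2 * s))
        ((Im (?g (y + s)) - Im (?g (y - s))) / (2 * s)) / \<i>) \<longlongrightarrow> Complex a b / \<i>) (at_right 0)"
      by (intro tendsto_intros) auto
    moreover have "Complex ((Re (?g (y + s)) - Re (?g (y - s))) / (2 * s))
        ((Im (?g (y + s)) - Im (?g (y - s))) / (2 * s)) / \<i> = boundary_quotient \<Phi> y s" for s
    proof -
      have "Complex ((Re (?g (y + s)) - Re (?g (y - s))) / (2 * s))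
        ((Im (?g (y + s)) - Im (?g (y - s))) / (2 * s)) = (?g (y + s) - ?g (y - s)) / of_real (2 * s)"
        by (simp only: complex_eq_iff Re_divide_of_real Im_divide_of_real minus_complex.sel complex.sel)
      then show ?thesis
        by (simp only: boundary_quotient_def divide_divide_eq_left of_real_mult of_real_numeral mult_ac)
    qed
    ultimately have "(boundary_quotient \<Phi> y \<longlongrightarrow> Complex a b / \<i>) (at_right 0)"
      by (simp only:)
    then show ?case ..
  qed
qed

lemma AE_boundary_limit: "AE y in lborel. ((\<lambda>x. \<phi> (Complex x y)) \<longlongrightarrow> boundary_function \<phi> y) (at_right 0)"
  using AE_boundary_quotient_tendsto
proof eventually_elim
  case (elim y)
  then obtain l where "(boundary_quotient \<Phi> y \<longlongrightarrow> l) (at_right 0)"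
    by blast
  then have "((\<lambda>x. deriv \<Phi> (Complex x y)) \<longlongrightarrow> l) (at_right 0)"
    by (rule deriv_tendsto_boundary[OF holo lip])
  then have lim: "((\<lambda>x. \<phi> (Complex x y)) \<longlongrightarrow> l) (at_right 0)"
    by (rule Lim_transform_eventually) (auto simp: eventually_at_right_field deriv_eq intro!: exI[of _ 1])
  then have "boundary_function \<phi> y = l"
    unfolding boundary_function_def by (rule tendsto_Lim[rotated]) simp
  with lim show ?case by simp
qed

end

section \<open>The boundary function\<close>

locale bounded_half_plane_primitive =
  half_plane_primitive +
  assumes bounded: "\<And>z. Re z > 0 \<Longrightarrow> norm (\<phi> z) \<le> M"
begin

text \<open>Cauchy's inequality on the circle of radius \<open>Re z / 2\<close>, which stays inside
  the open half plane.\<close>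

lemma norm_deriv_le:
  assumes "Re z > 0"
  shows "norm (deriv \<phi> z) \<le> 2 * M / Re z"
proof -
  have pos: "Re w > 0" if "w \<in> cball z (Re z / 2)" for w
    using that abs_Re_le_cmod[of "z - w"] assms by (auto simp: dist_norm)
  have "norm ((deriv ^^ 1) \<phi> z) \<le> fact 1 * M / (Re z / 2) ^ 1"
  proof (rule Cauchy_inequality)
    have "\<phi> holomorphic_on cball z (Re z / 2)"
      using holo_deriv by (rule holomorphic_on_subset) (use pos in auto)
    then show "\<phi> holomorphic_on ball z (Re z / 2)" "continuous_on (cball z (Re z / 2)) \<phi>"
      by (rule holomorphic_on_subset[OF _ ball_subset_cball], rule holomorphic_on_imp_continuous_on)
    show "norm (\<phi> w) \<le> M" if "norm (z - w) = Re z / 2" for w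
      using that by (intro bounded pos) (auto simp: dist_norm)
  qed (use assms in auto)
  then show ?thesis by (simp add: mult.commute)
qed

text \<open>The derivative is at most \<open>2 * M / x\<close> to the right of the line. The bound
  depends on the ratio of \<open>x'\<close> to \<open>x\<close> only, so it controls \<phi> between
  consecutive points \<open>1 / n\<close> however close to the boundary.\<close>

lemma slowly_varying:
  assumes "0 < x" "x \<le> x'"
  shows "norm (\<phi> (Complex x y) - \<phi> (Complex x' y)) \<le> 2 * M * (x' - x) / x"
proof -
  let ?S = "{z. Re z \<ge> x}"
  have "norm (\<phi> (Complex x y) - \<phi> (Complex x' y)) \<le> 2 * M / x * norm (Complex x y - Complex x' y)"
  proof (rule field_differentiable_bound)
    show "convex ?S" by (rule convex_halfspace_Re_ge)
    fix z assume z: "z \<in> ?S"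
    show "(\<phi> has_field_derivative deriv \<phi> z) (at z within ?S)"
      using z assms by (intro has_field_derivative_at_within[OF holomorphic_derivI[OF holo_deriv open_halfspace_Re_gt]]) auto
    have "norm (deriv \<phi> z) \<le> 2 * M / Re z"
      using z assms by (intro norm_deriv_le) auto
    also have "\<dots> \<le> 2 * M / x"
      using z assms M_nonneg by (intro divide_left_mono) auto
    finally show "norm (deriv \<phi> z) \<le> 2 * M / x" .
  qed (use assms in auto)
  also have "Complex x y - Complex x' y = of_real (x - x')"
    by (simp add: complex_eq_iff)
  finally show ?thesis
    using assms by (simp flip: of_real_diff)
qed

text \<open>
  Both limits exist for the same \<open>y\<close>, so \<^const>\<open>boundary_function\<close> is a sequential limit for every
  \<open>y\<close>, including those where \<^const>\<open>Lim\<close> is junk; this gives Borel measurability, not just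
  measurability up to a null set.
\<close>

lemma tendsto_at_right_iff_sequentially:
  "((\<lambda>x. \<phi> (Complex x y)) \<longlongrightarrow> l) (at_right 0) \<longleftrightarrow> (\<lambda>n. \<phi> (Complex (1 / Suc n) y)) \<longlonglongrightarrow> l"
proof
  assume "((\<lambda>x. \<phi> (Complex x y)) \<longlongrightarrow> l) (at_right 0)"
  moreover have "filterlim (\<lambda>n. 1 / real (Suc n)) (at_right 0) sequentially"
    by real_asymp
  ultimately show "(\<lambda>n. \<phi> (Complex (1 / Suc n) y)) \<longlonglongrightarrow> l"
    by (rule filterlim_compose)
next
  assume lim: "(\<lambda>n. \<phi> (Complex (1 / Suc n) y)) \<longlonglongrightarrow> l"
  \<comment> \<open>For \<open>0 < x < 1\<close> the integer part of \<open>1 / x\<close> is at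
    least 1, so \<open>Suc (N x)\<close> equals it and \<open>1 / Suc (N x)\<close> is the smallest
    \<open>1 / n\<close> that is not below \<open>x\<close>.\<close>
  define N where "N x = nat \<lfloor>1 / x\<rfloor> - 1" for x :: real
  have "filterlim (\<lambda>x::real. \<lfloor>1 / x\<rfloor>) at_top (at_right 0)"
    by real_asymp
  then have "filterlim (\<lambda>x. nat \<lfloor>1 / x\<rfloor>) at_top (at_right (0::real))"
    by (rule filterlim_compose[OF filterlim_nat_sequentially])
  then have N: "filterlim N at_top (at_right 0)"
    unfolding N_def by (rule filterlim_compose[OF filterlim_minus_const_nat_at_top])
  have 1: "((\<lambda>x. \<phi> (Complex (1 / Suc (N x)) y)) \<longlongrightarrow> l) (at_right 0)"
    by (rule filterlim_compose[OF lim N])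
  have "((\<lambda>x. \<phi> (Complex x y) - \<phi> (Complex (1 / Suc (N x)) y)) \<longlongrightarrow> 0) (at_right 0)"
  proof (rule tendsto_norm_zero_cancel, rule tendsto_sandwich[OF _ _ tendsto_const])
    have "filterlim (\<lambda>x. real (Suc (N x))) at_top (at_right 0)"
      by (intro filterlim_compose[OF filterlim_real_sequentially] filterlim_compose[OF filterlim_Suc] N)
    then show "((\<lambda>x. 2 * M / real (Suc (N x))) \<longlongrightarrow> 0) (at_right 0)"
      by (rule real_tendsto_divide_at_top[OF tendsto_const])
    have "eventually (\<lambda>x::real. x \<in> {0<..<1}) (at_right 0)"
      by (rule eventually_at_right_real) simp
    then show "eventually (\<lambda>x. norm (\<phi> (Complex x y) - \<phi> (Complex (1 / Suc (N x)) y)) \<le> 2 * M / real (Suc (N x))) (at_right 0)"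
    proof eventually_elim
      case (elim x)
      then have elim: "0 < x" "x < 1" by auto
      define k where "k = real (Suc (N x))"
      have "1 / x \<ge> 1" using elim by simp
      then have fl: "\<lfloor>1 / x\<rfloor> \<ge> 1" by linarith
      then have "Suc (N x) = nat \<lfloor>1 / x\<rfloor>"
        unfolding N_def by linarith
      with fl have k: "k = of_int \<lfloor>1 / x\<rfloor>" "k \<ge> 1"
        unfolding k_def by linarith+
      have "k \<le> 1 / x" "1 / x < k + 1"
        unfolding k(1) by linarith+
      then have x: "k * x \<le> 1" "1 < (k + 1) * x"
        using elim by (auto simp: field_simps)
      then have "x \<le> 1 / k"
        using k(2) by (simp add: field_simps)
      then have "norm (\<phi> (Complex x y) - \<phi> (Complex (1 / k) y)) \<le> 2 * M * (1 / k - x) / x"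
        using elim by (intro slowly_varying) auto
      \<comment> \<open>Since \<open>1 < (k + 1) * x\<close>, the gap \<open>1 / k - x\<close> is at
        most \<open>x / k\<close>. The factor \<open>x\<close> cancels and \<open>2 * M / k\<close>
        remains, which tends to 0.\<close>
      also have "2 * M * (1 / k - x) / x \<le> 2 * M * (x / k) / x"
      proof -
        have "1 / k \<le> (k + 1) * x / k"
          using x(2) k(2) by (intro divide_right_mono) auto
        also have "\<dots> = x + x / k"
          using k(2) by (simp add: distrib_right add_divide_distrib)
        finally have "1 / k - x \<le> x / k" by simp
        then show ?thesis
          using elim M_nonneg by (intro divide_right_mono mult_left_mono) auto
      qed
      also have "\<dots> = 2 * M / k"
        using elim by simp
      finally show ?case by (simp add: k_def)
    qed
  qed auto
  from tendsto_add[OF this 1] show "((\<lambda>x. \<phi> (Complex x y)) \<longlongrightarrow> l) (at_right 0)"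
    by simp
qed

lemma continuous_on_vertical:
  assumes "x > 0"
  shows "continuous_on A (\<lambda>t. \<phi> (Complex x t))"
  unfolding Complex_eq using assms
  by (intro continuous_on_compose2[OF holomorphic_on_imp_continuous_on[OF holo_deriv]] continuous_intros) auto

lemma borel_measurable_boundary_function: "boundary_function \<phi> \<in> borel_measurable borel"
proof -
  have [measurable]: "(\<lambda>t. \<phi> (Complex (1 / Suc n) t)) \<in> borel_measurable borel" for n
    by (intro borel_measurable_continuous_onI continuous_on_vertical) simp
  have "boundary_function \<phi> = (\<lambda>y. lim (\<lambda>n. \<phi> (Complex (1 / Suc n) y)))"
    by (intro ext) (simp only: boundary_function_def t2_space_class.Lim_def tendsto_at_right_iff_sequentially)
  also have "\<dots> \<in> borel_measurable borel"
    by measurable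
  finally show ?thesis .
qed

text \<open>The fundamental theorem of calculus holds on each line \<open>Re z = 1 / Suc n\<close>.
  The integrals converge by dominated convergence with bound \<open>M\<close>, and the end point
  values converge by the Lipschitz condition.\<close>

lemma boundary_function_integral:
  assumes "a \<le> b"
  shows "set_integrable lborel {a..b} (boundary_function \<phi>)"
    and "(LINT t:{a..b}|lborel. boundary_function \<phi> t) = (\<Phi> (Complex 0 b) - \<Phi> (Complex 0 a)) / \<i>"
proof -
  note [measurable] = borel_measurable_boundary_function
  let ?f = "\<lambda>n t. indicator {a..b} t *\<^sub>R \<phi> (Complex (1 / Suc n) t)"
  let ?f' = "\<lambda>t. indicator {a..b} t *\<^sub>R boundary_function \<phi> t"
  have meas: "(\<lambda>t. \<phi> (Complex (1 / Suc n) t)) \<in> borel_measurable borel" for n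
    by (intro borel_measurable_continuous_onI continuous_on_vertical) simp
  have dom: "integrable lborel (\<lambda>t. indicator {a..b} t * M)"
    using assms by (intro integrable_mult_left integrable_real_indicator) auto
  have conv: "AE t in lborel. (\<lambda>n. ?f n t) \<longlonglongrightarrow> ?f' t"
    using AE_boundary_limit
  proof eventually_elim
    case (elim t)
    then show ?case
      by (intro tendsto_intros) (simp add: tendsto_at_right_iff_sequentially)
  qed
  have bound: "AE t in lborel. norm (?f n t) \<le> indicator {a..b} t * M" for n
    by (intro AE_I2) (auto simp: indicator_def bounded)
  have m: "?f' \<in> borel_measurable lborel" "?f n \<in> borel_measurable lborel" for n
    using meas by auto
  show "set_integrable lborel {a..b} (boundary_function \<phi>)"
    unfolding set_integrable_def using m dom conv bound by (rule integrable_dominated_convergence)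
  have "(\<lambda>n. integral\<^sup>L lborel (?f n)) \<longlonglongrightarrow> integral\<^sup>L lborel ?f'"
    using m dom conv bound by (rule integral_dominated_convergence)
  moreover have "integral\<^sup>L lborel (?f n) = \<Phi> (Complex (1 / Suc n) b) / \<i> - \<Phi> (Complex (1 / Suc n) a) / \<i>" for n
    using assms by (intro integral_FTC_Icc vertical_derivative continuous_on_vertical) auto
  moreover have "(\<lambda>n. \<Phi> (Complex (1 / Suc n) t)) \<longlonglongrightarrow> \<Phi> (Complex 0 t)" for t
  proof (rule LIM_zero_cancel, rule Lim_null_comparison)
    show "eventually (\<lambda>n. norm (\<Phi> (Complex (1 / Suc n) t) - \<Phi> (Complex 0 t)) \<le> M * (1 / Suc n)) sequentially"
      by (intro always_eventually allI lipschitz_horizontal) simp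
    show "(\<lambda>n. M * (1 / Suc n)) \<longlonglongrightarrow> 0"
      by (intro tendsto_mult_right_zero lim_1_over_n[THEN LIMSEQ_Suc])
  qed
  then have "(\<lambda>n. \<Phi> (Complex (1 / Suc n) b) / \<i> - \<Phi> (Complex (1 / Suc n) a) / \<i>)
      \<longlonglongrightarrow> \<Phi> (Complex 0 b) / \<i> - \<Phi> (Complex 0 a) / \<i>"
    by (intro tendsto_intros) auto
  ultimately have "integral\<^sup>L lborel ?f' = \<Phi> (Complex 0 b) / \<i> - \<Phi> (Complex 0 a) / \<i>"
    by (auto intro: LIMSEQ_unique)
  then show "(LINT t:{a..b}|lborel. boundary_function \<phi> t) = (\<Phi> (Complex 0 b) - \<Phi> (Complex 0 a)) / \<i>"
    by (simp only: set_lebesgue_integral_def diff_divide_distrib)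
qed

lemma boundary_average:
  assumes "\<theta> > 0"
  shows "1 / (2 * \<theta>) * (LINT t:{y - \<theta>..y + \<theta>}|lborel. Re (boundary_function \<phi> t)) =
      Re (boundary_quotient \<Phi> y \<theta>)"
    and "1 / (2 * \<theta>) * (LINT t:{y - \<theta>..y + \<theta>}|lborel. Im (boundary_function \<phi> t)) =
      Im (boundary_quotient \<Phi> y \<theta>)"
proof -
  let ?I = "LINT t:{y - \<theta>..y + \<theta>}|lborel. boundary_function \<phi> t"
  have int: "integrable lborel (\<lambda>t. indicator {y - \<theta>..y + \<theta>} t *\<^sub>R boundary_function \<phi> t)"
    using boundary_function_integral(1)[of "y - \<theta>" "y + \<theta>"] assms by (simp add: set_integrable_def)
  have "y - \<theta> \<le> y + \<theta>"
    using assms by simp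
  then have "boundary_quotient \<Phi> y \<theta> = ?I / of_real (2 * \<theta>)"
    by (simp only: boundary_function_integral(2) boundary_quotient_def divide_divide_eq_left
        of_real_mult of_real_numeral mult_ac)
  then have *: "Re (boundary_quotient \<Phi> y \<theta>) = Re ?I / (2 * \<theta>)"
    "Im (boundary_quotient \<Phi> y \<theta>) = Im ?I / (2 * \<theta>)"
    by (simp_all only: Re_divide_of_real Im_divide_of_real)
  have "(LINT t:{y - \<theta>..y + \<theta>}|lborel. Re (boundary_function \<phi> t)) = Re ?I"
    "(LINT t:{y - \<theta>..y + \<theta>}|lborel. Im (boundary_function \<phi> t)) = Im ?I"
    using integral_Re[OF int] integral_Im[OF int] by (simp_all add: set_lebesgue_integral_def)
  with * show "1 / (2 * \<theta>) * (LINT t:{y - \<theta>..y + \<theta>}|lborel. Re (boundary_function \<phi> t)) =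
      Re (boundary_quotient \<Phi> y \<theta>)"
    "1 / (2 * \<theta>) * (LINT t:{y - \<theta>..y + \<theta>}|lborel. Im (boundary_function \<phi> t)) =
      Im (boundary_quotient \<Phi> y \<theta>)"
    by simp_all
qed

end

section \<open>Construction of the primitive and conclusion\<close>

text \<open>A holomorphic function on the convex open half plane has a primitive there. The bound on
  \<phi> makes it \<open>M\<close>-Lipschitz by convexity, so it extends to the closure with the
  same constant.\<close>

lemma H_infinity_primitive:
  assumes "\<phi> \<in> H_infinity"
  obtains \<Phi> M where "bounded_half_plane_primitive \<Phi> \<phi> M"
proof -
  let ?H = "{z::complex. Re z > 0}"
  have "\<phi> analytic_on ?H" "bounded (\<phi> ` ?H)"
    using assms by (auto simp: H_infinity_def right_half_plane_def)
  then obtain M where M: "\<And>z. Re z > 0 \<Longrightarrow> norm (\<phi> z) \<le> M"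
    by (auto simp: bounded_iff)
  have "M \<ge> 0"
    using order_trans[OF norm_ge_zero M[of 1]] by simp
  have "convex ?H" "open ?H"
    by (auto simp: convex_halfspace_Re_gt open_halfspace_Re_gt)
  then obtain \<Phi>0 where \<Phi>0: "\<And>z. z \<in> ?H \<Longrightarrow> (\<Phi>0 has_field_derivative \<phi> z) (at z within ?H)"
    using holomorphic_convex_primitive' analytic_imp_holomorphic[OF \<open>\<phi> analytic_on ?H\<close>] by blast
  have "M-lipschitz_on ?H \<Phi>0"
    using field_differentiable_bound[OF \<open>convex ?H\<close> \<Phi>0] M \<open>M \<ge> 0\<close>
    by (intro lipschitz_onI) (auto simp: dist_norm)
  then obtain \<Phi> where \<Phi>: "M-lipschitz_on (closure ?H) \<Phi>" "\<And>z. z \<in> ?H \<Longrightarrow> \<Phi> z = \<Phi>0 z"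
    using lipschitz_extend_closure by blast
  have "closure ?H = {z. Re z \<ge> 0}"
    using closure_halfspace_gt[of "1::complex" 0] by (simp add: inner_complex_def)
  moreover have "(\<Phi> has_field_derivative \<phi> z) (at z)" if "Re z > 0" for z
  proof (rule has_field_derivative_transform_within_open)
    show "(\<Phi>0 has_field_derivative \<phi> z) (at z)"
      using \<Phi>0[of z] that at_within_open[OF _ \<open>open ?H\<close>, of z] by simp
  qed (use \<Phi>(2) that \<open>open ?H\<close> in auto)
  ultimately have "bounded_half_plane_primitive \<Phi> \<phi> M"
    using \<Phi>(1) M by unfold_locales auto
  then show ?thesis by (rule that)
qed

theorem theorem4p1:
  fixes \<phi> :: "complex \<Rightarrow> complex"
  assumes "\<phi> \<in> H_infinity"
  shows "(Limsup at_top (\<lambda>\<theta>. SUP y. ereal (1 / (2 * \<theta>) *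
             (LINT t:{y - \<theta>..y + \<theta>}|lborel. Re (boundary_function \<phi> t))))
           = Limsup at_top (\<lambda>x. SUP y. ereal (Re (\<phi> (Complex x y)))))
       \<and> (Liminf at_top (\<lambda>\<theta>. INF y. ereal (1 / (2 * \<theta>) *
             (LINT t:{y - \<theta>..y + \<theta>}|lborel. Re (boundary_function \<phi> t))))
           = Liminf at_top (\<lambda>x. INF y. ereal (Re (\<phi> (Complex x y)))))
       \<and> (Limsup at_top (\<lambda>\<theta>. SUP y. ereal (1 / (2 * \<theta>) *
             (LINT t:{y - \<theta>..y + \<theta>}|lborel. Im (boundary_function \<phi> t))))
           = Limsup at_top (\<lambda>x. SUP y. ereal (Im (\<phi> (Complex x y)))))
       \<and> (Liminf at_top (\<lambda>\<theta>. INF y. ereal (1 / (2 * \<theta>) *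
             (LINT t:{y - \<theta>..y + \<theta>}|lborel. Im (boundary_function \<phi> t))))
           = Liminf at_top (\<lambda>x. INF y. ereal (Im (\<phi> (Complex x y)))))"
proof -
  obtain \<Phi> M where "bounded_half_plane_primitive \<Phi> \<phi> M"
    using H_infinity_primitive[OF assms] .
  then interpret bounded_half_plane_primitive \<Phi> \<phi> M .
  \<comment> \<open>Averages and quotients are identified only for \<open>\<theta> > 0\<close>,
    which suffices at infinity. The functional \<open>F\<close> stands for the supremum or the
    infimum over \<open>y\<close>.\<close>
  have re: "eventually (\<lambda>\<theta>. F (\<lambda>y. ereal (1 / (2 * \<theta>) *
      (LINT t:{y - \<theta>..y + \<theta>}|lborel. Re (boundary_function \<phi> t)))) =
      F (\<lambda>y. ereal (Re (boundary_quotient \<Phi> y \<theta>)))) at_top"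
    and im: "eventually (\<lambda>\<theta>. F (\<lambda>y. ereal (1 / (2 * \<theta>) *
      (LINT t:{y - \<theta>..y + \<theta>}|lborel. Im (boundary_function \<phi> t)))) =
      F (\<lambda>y. ereal (Im (boundary_quotient \<Phi> y \<theta>)))) at_top" for F :: "(real \<Rightarrow> ereal) \<Rightarrow> ereal"
    using eventually_gt_at_top[of 0] by (rule eventually_mono; simp only: boundary_average)+
  show ?thesis
    unfolding Limsup_eq[OF re[of "\<lambda>f. SUP y. f y"]] Liminf_eq[OF re[of "\<lambda>f. INF y. f y"]]
      Limsup_eq[OF im[of "\<lambda>f. SUP y. f y"]] Liminf_eq[OF im[of "\<lambda>f. INF y. f y"]]
    by (intro conjI Limsup_boundary_quotient Liminf_boundary_quotient
        Limsup_Im_boundary_quotient Liminf_Im_boundary_quotient)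
qed

end
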